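(* Let $c>1$ and $p,q,r\ge0$ with $p+q+r=1$, $p+r>0$, $q+r>0$. For $k\in\mathbb{Z}$ the distribution $\mu^{(k)}$ is $c^{-1}$-decomposable and satisfies $$\widehat\mu^{(k)}(z)=\widehat\rho^{(k)}(z)\,\widehat\mu^{(k)}(c^{-1}z),\quad z\in\mathbb{R}.$$ The characteristic function of $\mu^{(k)}$ has the expression $$\widehat\mu^{(k)}(z)=\prod_{n=0}^\infty\widehat\rho^{(k)}(c^{-n}z),\quad z\in\mathbb{R}.$$
   Context: For $k\in\mathbb{Z}$ let $\{(N_t^{(k)},L_t^{(k)}),t\ge0\}$ be the bivariate compound Poisson process (pure jump, no drift) with $E[e^{i(z_1N_t^{(k)}+z_2L_t^{(k)})}]=\exp[t\int_{\mathbb{R}^2}(e^{i(z_1x_1+z_2x_2)}-1)\nu^{(k)}(dx)]$, where $\nu^{(k)}$ is concentrated on the points $(1,0)$, $(0,1)$, $(1,c^{-k})$ with masses $u,v,w\ge0$ respectively, and $p=u/(u+v+w)$, $q=v/(u+v+w)$, $r=w/(u+v+w)$. Let $T$ be the first jump time of $\{N_t^{(k)}\}$. Define $\rho^{(k)}$ as the distribution of $L_T^{(k)}$, and $\mu^{(k)}$ as the distribution of $\int_0^{\infty-}c^{-N^{(k)}_{s-}}\,dL_s^{(k)}$ (the almost sure limit of $\int_0^t$ as $t\to\infty$, which exists). $\widehat\sigma$ denotes the characteristic function of $\sigma$. For $b\in(0,1)$, a distribution $\sigma$ on $\mathbb{R}$ is $b$-decomposable if there is a distribution $\rho$ on $\mathbb{R}$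 such that $\widehat\sigma(z)=\widehat\rho(z)\widehat\sigma(bz)$ for all $z\in\mathbb{R}$. *)

theory Defs
  imports "HOL-Probability.Probability"
begin

text \<open>
  Levy processes on \<open>[0, \<infinity>)\<close> with values in a Euclidean space. Time is a real number, and
  only the values \<open>X t\<close> with \<open>t \<ge> 0\<close> matter.
\<close>

definition cadlag :: "(real \<Rightarrow> 'b::topological_space) \<Rightarrow> bool" where
  "cadlag f \<longleftrightarrow>
     (\<forall>t\<ge>0. (f \<longlongrightarrow> f t) (at_right t)) \<and> (\<forall>t>0. \<exists>l. (f \<longlongrightarrow> l) (at_left t))"

definition independent_increments ::
  "'a measure \<Rightarrow> (real \<Rightarrow> 'a \<Rightarrow> 'b::euclidean_space) \<Rightarrow> bool" where
  "independent_increments M X \<longleftrightarrow>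
     (\<forall>(n::nat) (t::nat \<Rightarrow> real). 0 \<le> t 0 \<and> (\<forall>i<n. t i < t (Suc i)) \<longrightarrow>
        prob_space.indep_vars M (\<lambda>_. borel) (\<lambda>i \<omega>. X (t (Suc i)) \<omega> - X (t i) \<omega>) {..<n})"

definition stationary_increments ::
  "'a measure \<Rightarrow> (real \<Rightarrow> 'a \<Rightarrow> 'b::euclidean_space) \<Rightarrow> bool" where
  "stationary_increments M X \<longleftrightarrow>
     (\<forall>s\<ge>0. \<forall>t\<ge>0. distr M borel (\<lambda>\<omega>. X (s + t) \<omega> - X s \<omega>) = distr M borel (\<lambda>\<omega>. X t \<omega> - X 0 \<omega>))"

definition stochastically_continuous ::
  "'a measure \<Rightarrow> (real \<Rightarrow> 'a \<Rightarrow> 'b::euclidean_space) \<Rightarrow> bool" where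
  "stochastically_continuous M X \<longleftrightarrow>
     (\<forall>t\<ge>0. \<forall>\<epsilon>>0. ((\<lambda>s. measure M {\<omega> \<in> space M. dist (X s \<omega>) (X t \<omega>) > \<epsilon>}) \<longlongrightarrow> 0) (at t within {0..}))"

definition levy_process ::
  "'a measure \<Rightarrow> (real \<Rightarrow> 'a \<Rightarrow> 'b::euclidean_space) \<Rightarrow> bool" where
  "levy_process M X \<longleftrightarrow>
     prob_space M \<and>
     (\<forall>t\<ge>0. X t \<in> borel_measurable M) \<and>
     (AE \<omega> in M. X 0 \<omega> = 0) \<and>
     independent_increments M X \<and>
     stationary_increments M X \<and>
     stochastically_continuous M X \<and>
     (AE \<omega> in M. cadlag (\<lambda>t. X t \<omega>))"

text \<open>
  A compound Poisson process is a Levy process whose Levy measure \<open>\<nu>\<close> is finite and which has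
  neither drift nor Gaussian part, as expressed by its characteristic function.
\<close>

definition compound_poisson_process ::
  "'a measure \<Rightarrow> 'b::euclidean_space measure \<Rightarrow> (real \<Rightarrow> 'a \<Rightarrow> 'b) \<Rightarrow> bool" where
  "compound_poisson_process M \<nu> X \<longleftrightarrow>
     levy_process M X \<and>
     finite_measure \<nu> \<and> sets \<nu> = sets borel \<and> emeasure \<nu> {0} = 0 \<and>
     (\<forall>t\<ge>0. \<forall>z.
        (CLINT \<omega>|M. iexp (z \<bullet> X t \<omega>)) = exp (of_real t * (CLINT x|\<nu>. iexp (z \<bullet> x) - 1)))"

text \<open>
  The three atoms are distinct because \<open>c powi (- k) > 0\<close> for \<open>c > 1\<close>.
\<close>

definition levy_measure_k ::
  "real \<Rightarrow> int \<Rightarrow> real \<Rightarrow> real \<Rightarrow> real \<Rightarrow> (real \<times> real) measure" where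
  "levy_measure_k c k u v w =
     distr
       (point_measure {(1, 0), (0, 1), (1, c powi (- k))}
          (\<lambda>x. ennreal (if x = (1, 0) then u else if x = (0, 1) then v else w)))
       borel (\<lambda>x. x)"

definition left_limit :: "(real \<Rightarrow> real) \<Rightarrow> real \<Rightarrow> real" where
  "left_limit f t = Lim (at_left t) f"

definition first_jump_time :: "(real \<Rightarrow> real) \<Rightarrow> real" where
  "first_jump_time f = Inf {t. 0 < t \<and> f t \<noteq> left_limit f t}"

text \<open>
  The pathwise Lebesgue-Stieltjes integral of \<open>f\<close> with respect to \<open>g\<close> over \<open>{0<..t}\<close>, for \<open>g\<close>
  nondecreasing and right-continuous on \<open>[0, \<infinity>)\<close>. Almost all paths of the second component
  of a compound Poisson process with Levy measure \<^const>\<open>levy_measure_k\<close> are of this kind, since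
  their jumps are positive.
\<close>

definition stieltjes_integral :: "(real \<Rightarrow> real) \<Rightarrow> (real \<Rightarrow> real) \<Rightarrow> real \<Rightarrow> real" where
  "stieltjes_integral f g t = (LINT s:{0<..t}|interval_measure (\<lambda>s. g (max 0 s)). f s)"

text \<open>
  The first jump time and the limit of the integrals are meaningful only for almost all \<open>\<omega>\<close>, and on
  the exceptional null set the expressions below take arbitrary values. Their laws are therefore
  taken with respect to the completion of \<open>M\<close>, in which altering a random variable
  on a null set affects neither its measurability nor its law.
\<close>

definition rho :: "'a measure \<Rightarrow> (real \<Rightarrow> 'a \<Rightarrow> real) \<Rightarrow> (real \<Rightarrow> 'a \<Rightarrow> real) \<Rightarrow> real measure" where
  "rho M N L = distr (completion M) borel (\<lambda>\<omega>. L (first_jump_time (\<lambda>t. N t \<omega>)) \<omega>)"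

definition mu ::
  "real \<Rightarrow> 'a measure \<Rightarrow> (real \<Rightarrow> 'a \<Rightarrow> real) \<Rightarrow> (real \<Rightarrow> 'a \<Rightarrow> real) \<Rightarrow> real measure" where
  "mu c M N L = distr (completion M) borel
     (\<lambda>\<omega>. Lim at_top
        (stieltjes_integral (\<lambda>s. c powr (- left_limit (\<lambda>t. N t \<omega>) s)) (\<lambda>t. L t \<omega>)))"

definition decomposable :: "real \<Rightarrow> real measure \<Rightarrow> bool" where
  "decomposable b \<sigma> \<longleftrightarrow>
     0 < b \<and> b < 1 \<and> real_distribution \<sigma> \<and>
     (\<exists>\<rho>. real_distribution \<rho> \<and> (\<forall>z. char \<sigma> z = char \<rho> z * char \<sigma> (b * z)))"

end

theory Submission
  imports Defs
begin

text \<open>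
  On the grid of mesh \<open>h\<close> the increments of \<open>(N, L)\<close> are i.i.d., and conditioning on the first one
  gives \<open>\<phi>\<^sub>n\<^sub>+\<^sub>1(z) = a(z) \<phi>\<^sub>n(z) + b(z) \<phi>\<^sub>n(z / c)\<close> for the characteristic function \<open>\<phi>\<^sub>n\<close> of the left Riemann
  sum with \<open>n\<close> terms, up to the probability that \<open>N\<close> increases by at least \<open>2\<close> in one step, which is
  \<open>O(h\<^sup>2)\<close>; here \<open>a\<close> and \<open>b\<close> are the expectations of \<open>exp (i z L\<^sub>h)\<close> over \<open>{N\<^sub>h = 0}\<close> and \<open>{N\<^sub>h \<noteq> 0}\<close>. The value \<open>\<psi>\<close>
  of the characteristic function of \<open>L\<close> at the first grid point after \<open>T\<close> solves \<open>\<psi> (1 - a) = b\<close> exactly.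
  As \<open>\<bar>1 - a\<bar>\<close> is at least of order \<open>h\<close> and \<open>\<phi>\<^sub>n\<^sub>+\<^sub>1 - \<phi>\<^sub>n\<close> is \<open>h\<close> times an exponentially small function of the horizon \<open>n h\<close>,
  letting \<open>h \<rightarrow> 0\<close> and then the horizon tend to infinity gives \<open>\<mu>(z) = \<rho>(z) \<mu>(z / c)\<close>. No strong Markov
  property is needed, and of the joint law of \<open>(N, L)\<close> only the two marginals enter.
\<close>

section \<open>Poisson laws\<close>

text \<open>The sum is the exponential series rescaled by \<open>exp (- rate)\<close>. The field is
  left open because two kinds of \<open>x\<close> are substituted later: the complex
  \<open>iexp y\<close> for characteristic functions and the real \<open>1 / c\<close> for the mean
  of c^(-N).\<close>

lemma
  fixes x :: "'a :: {banach, real_normed_field, second_countable_topology}"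
  assumes "rate > 0"
  shows integrable_poisson_pmf_power: "norm x \<le> 1 \<Longrightarrow> integrable (measure_pmf (poisson_pmf rate)) (\<lambda>n. x ^ n)"
    and expectation_poisson_pmf_power:
      "norm x \<le> 1 \<Longrightarrow> measure_pmf.expectation (poisson_pmf rate) (\<lambda>n. x ^ n) = exp (of_real rate * (x - 1))"
proof -
  assume x: "norm x \<le> 1"
  show int: "integrable (measure_pmf (poisson_pmf rate)) (\<lambda>n. x ^ n)"
    by (rule measure_pmf.integrable_const_bound[where B=1])
       (use x in \<open>auto simp: norm_power power_le_one\<close>)
  let ?f = "\<lambda>n. pmf (poisson_pmf rate) n *\<^sub>R x ^ n"
  have "integrable (count_space UNIV) ?f"
    using int unfolding measure_pmf_eq_density
    by (subst (asm) integrable_density) auto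
  then have "?f sums integral\<^sup>L (count_space UNIV) ?f"
    by (rule sums_integral_count_space_nat)
  moreover have "integral\<^sup>L (count_space UNIV) ?f = measure_pmf.expectation (poisson_pmf rate) (\<lambda>n. x ^ n)"
    unfolding measure_pmf_eq_density by (subst integral_density) auto
  ultimately have s: "?f sums measure_pmf.expectation (poisson_pmf rate) (\<lambda>n. x ^ n)"
    by simp
  have "(\<lambda>n. exp (- rate) *\<^sub>R ((of_real rate * x) ^ n /\<^sub>R fact n)) sums (exp (- rate) *\<^sub>R exp (of_real rate * x))"
    by (intro sums_scaleR_right exp_converges)
  also have "(\<lambda>n. exp (- rate) *\<^sub>R ((of_real rate * x) ^ n /\<^sub>R fact n)) = ?f"
    using assms by (auto simp: fun_eq_iff scaleR_conv_of_real power_mult_distrib field_simps)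
  finally have "measure_pmf.expectation (poisson_pmf rate) (\<lambda>n. x ^ n) = exp (- rate) *\<^sub>R exp (of_real rate * x)"
    using s sums_unique2 by blast
  also have "\<dots> = exp (of_real rate * (x - 1))"
  proof -
    have "exp (of_real rate * (x - 1)) = exp (of_real (- rate) + of_real rate * x)"
      by (simp add: algebra_simps)
    then show ?thesis
      by (simp only: exp_add exp_of_real scaleR_conv_of_real)
  qed
  finally show "measure_pmf.expectation (poisson_pmf rate) (\<lambda>n. x ^ n) = exp (of_real rate * (x - 1))" .
qed

text \<open>Shifting the index turns n times the mass at n into \<open>rate\<close> times the mass
  at n - 1, so the series for the mean is again an exponential series.\<close>

lemma
  assumes "rate > 0"
  shows integrable_poisson_pmf_real: "integrable (measure_pmf (poisson_pmf rate)) real"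
    and expectation_poisson_pmf_real: "measure_pmf.expectation (poisson_pmf rate) real = rate"
proof -
  have "(\<lambda>n. exp (- rate) * rate * (rate ^ n /\<^sub>R fact n)) sums (exp (- rate) * rate * exp rate)"
    by (intro sums_mult exp_converges)
  then have "(\<lambda>n. pmf (poisson_pmf rate) (Suc n) * real (Suc n)) sums rate"
    using assms by (simp add: field_simps exp_minus del: of_nat_Suc)
  then have s: "(\<lambda>n. pmf (poisson_pmf rate) n * real n) sums rate"
    by (subst (asm) sums_Suc_iff) simp
  have "has_bochner_integral (count_space UNIV) (\<lambda>n. pmf (poisson_pmf rate) n *\<^sub>R real n) rate"
  proof -
    have i: "integrable (count_space UNIV) (\<lambda>n. pmf (poisson_pmf rate) n * real n)"
      unfolding integrable_count_space_nat_iff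
      using s by (simp add: abs_mult sums_iff)
    then show ?thesis using sums_integral_count_space_nat[OF i] s
      by (auto simp: has_bochner_integral_iff dest: sums_unique2)
  qed
  then have "has_bochner_integral (measure_pmf (poisson_pmf rate)) real rate"
    unfolding measure_pmf_eq_density by (intro has_bochner_integral_density) auto
  then show "integrable (measure_pmf (poisson_pmf rate)) real"
    and "measure_pmf.expectation (poisson_pmf rate) real = rate"
    by (auto simp: has_bochner_integral_iff)
qed

text \<open>Rate 0 is completed by the point mass at 0, since the masses \<open>v\<close> and
  \<open>w\<close> as well as the time may vanish.\<close>

definition poisson_law :: "real \<Rightarrow> nat pmf" where
  "poisson_law rate = (if rate = 0 then return_pmf 0 else poisson_pmf rate)"

lemma expectation_poisson_law_iexp:
  "0 \<le> rate \<Longrightarrow> measure_pmf.expectation (poisson_law rate) (\<lambda>n. iexp (x * real n)) = exp (rate * (iexp x - 1))"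
proof -
  assume rate: "0 \<le> rate"
  have eq: "iexp (x * real n) = iexp x ^ n" for n
    by (simp add: exp_of_nat_mult[symmetric] mult_ac)
  show ?thesis
  proof (cases "rate = 0")
    case False
    with rate have "0 < rate" by simp
    then show ?thesis
      unfolding eq poisson_law_def using False by (simp add: expectation_poisson_pmf_power del: of_real_mult)
  qed (simp add: poisson_law_def)
qed

lemma
  assumes "0 \<le> rate"
  shows integrable_poisson_law: "integrable (measure_pmf (poisson_law rate)) real"
    and expectation_poisson_law: "measure_pmf.expectation (poisson_law rate) real = rate"
  using assms integrable_poisson_pmf_real[of rate] expectation_poisson_pmf_real[of rate]
  by (auto simp: poisson_law_def integrable_measure_pmf_finite)

lemma char_distr_poisson_law:
  "0 \<le> rate \<Longrightarrow> char (distr (measure_pmf (poisson_law rate)) borel real) x = exp (rate * (iexp x - 1))"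
  unfolding char_def by (subst integral_distr) (auto simp: expectation_poisson_law_iexp simp del: of_real_mult)

text \<open>\<open>K\<close> is the law of A + d B for independent Poisson variables A and B. The
  law of \<open>L t\<close> is later identified with such a \<open>K\<close> by its characteristic
  function, which hands positivity, integrability and the mean over to \<open>L t\<close>.\<close>

lemma ex_compound_poisson_two_atoms:
  assumes a: "0 \<le> a" and b: "0 \<le> b" and d: "0 \<le> d"
  obtains K where "real_distribution K"
    "\<And>x. char K x = exp (a * (iexp x - 1) + b * (iexp (x * d) - 1))"
    "AE y in K. 0 \<le> y" "integrable K (\<lambda>y. y)" "integral\<^sup>L K (\<lambda>y. y) = a + d * b"
proof
  let ?A = "measure_pmf (poisson_law a)" and ?B = "measure_pmf (poisson_law b)"
  interpret AB: pair_prob_space ?A ?B ..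
  interpret BA: pair_prob_space ?B ?A ..
  let ?f = "\<lambda>p. real (fst p) + d * real (snd p)"
  have fst: "distr (?A \<Otimes>\<^sub>M ?B) ?A fst = ?A"
    by (rule measure_pmf.distr_pair_fst)
  have snd: "distr (?A \<Otimes>\<^sub>M ?B) ?B snd = ?B"
  proof -
    have "distr (?A \<Otimes>\<^sub>M ?B) ?B snd = distr (distr (?B \<Otimes>\<^sub>M ?A) (?A \<Otimes>\<^sub>M ?B) (\<lambda>(x, y). (y, x))) ?B snd"
      using AB.distr_pair_swap by simp
    also have "\<dots> = distr (?B \<Otimes>\<^sub>M ?A) ?B fst"
      by (subst distr_distr) (auto simp: comp_def case_prod_beta intro!: distr_cong)
    finally show ?thesis
      by (simp add: measure_pmf.distr_pair_fst)
  qed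
  have [measurable]: "(\<lambda>p. real (fst p)) \<in> borel_measurable (?A \<Otimes>\<^sub>M ?B)"
    "(\<lambda>p. real (snd p)) \<in> borel_measurable (?A \<Otimes>\<^sub>M ?B)"
    by measurable
  have f [measurable]: "?f \<in> borel_measurable (?A \<Otimes>\<^sub>M ?B)"
    by measurable
  define K where "K = distr (?A \<Otimes>\<^sub>M ?B) borel ?f"
  show "real_distribution K"
    unfolding K_def using f by (rule AB.real_distribution_distr)
  show "AE y in K. 0 \<le> y"
    unfolding K_def using d by (subst AE_distr_iff) auto
  have i: "integrable (?A \<Otimes>\<^sub>M ?B) (\<lambda>p. real (fst p))" "integrable (?A \<Otimes>\<^sub>M ?B) (\<lambda>p. real (snd p))"
    using integrable_poisson_law[OF a] integrable_poisson_law[OF b]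
      integrable_distr[of fst "?A \<Otimes>\<^sub>M ?B" ?A real] integrable_distr[of snd "?A \<Otimes>\<^sub>M ?B" ?B real]
    by (simp_all add: fst snd)
  then show "integrable K (\<lambda>y. y)"
    unfolding K_def by (subst integrable_distr_eq) auto
  have "integral\<^sup>L K (\<lambda>y. y) = (\<integral>p. real (fst p) \<partial>(?A \<Otimes>\<^sub>M ?B)) + d * (\<integral>p. real (snd p) \<partial>(?A \<Otimes>\<^sub>M ?B))"
    unfolding K_def using i by (subst integral_distr) auto
  also have "\<dots> = a + d * b"
    using integral_distr[of fst "?A \<Otimes>\<^sub>M ?B" ?A real] integral_distr[of snd "?A \<Otimes>\<^sub>M ?B" ?B real]
      expectation_poisson_law[OF a] expectation_poisson_law[OF b] by (simp add: fst snd)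
  finally show "integral\<^sup>L K (\<lambda>y. y) = a + d * b" .
  show "char K x = exp (a * (iexp x - 1) + b * (iexp (x * d) - 1))" for x
  proof -
    have "char K x = (\<integral>p. iexp (x * ?f p) \<partial>(?A \<Otimes>\<^sub>M ?B))"
      unfolding char_def K_def by (subst integral_distr) auto
    also have "\<dots> = (\<integral>m. (\<integral>n. iexp (x * ?f (m, n)) \<partial>?B) \<partial>?A)"
    proof (rule AB.integral_fst'[symmetric], rule AB.integrable_const_bound[where B=1])
      show "(\<lambda>p. iexp (x * ?f p)) \<in> borel_measurable (?A \<Otimes>\<^sub>M ?B)"
        by measurable
    qed (simp del: of_real_mult of_real_add)
    also have "\<dots> = (\<integral>m. iexp (x * real m) * exp (b * (iexp (x * d) - 1)) \<partial>?A)"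
    proof (intro Bochner_Integration.integral_cong refl)
      fix m
      have "iexp (x * ?f (m, n)) = iexp (x * real m) * iexp (x * d * real n)" for n
        unfolding exp_add[symmetric] by (simp add: algebra_simps)
      then have "(\<integral>n. iexp (x * ?f (m, n)) \<partial>?B) = (\<integral>n. iexp (x * real m) * iexp (x * d * real n) \<partial>?B)"
        by (simp only:)
      also have "\<dots> = iexp (x * real m) * (\<integral>n. iexp (x * d * real n) \<partial>?B)"
        by (rule integral_mult_right_zero)
      finally show "(\<integral>n. iexp (x * ?f (m, n)) \<partial>?B) = iexp (x * real m) * exp (b * (iexp (x * d) - 1))"
        unfolding expectation_poisson_law_iexp[OF b] .
    qed
    also have "\<dots> = (\<integral>m. iexp (x * real m) \<partial>?A) * exp (b * (iexp (x * d) - 1))"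
      by (rule integral_mult_left_zero)
    also have "\<dots> = exp (a * (iexp x - 1)) * exp (b * (iexp (x * d) - 1))"
      unfolding expectation_poisson_law_iexp[OF a] ..
    finally show ?thesis
      unfolding exp_add .
  qed
qed

section \<open>Weighted sums of i.i.d. steps\<close>

lemma norm_iexp_diff_le: "cmod (iexp x - iexp y) \<le> \<bar>x - y\<bar>"
proof -
  have "iexp x - iexp y = iexp y * (iexp (x - y) - 1)"
    by (simp add: algebra_simps exp_add[symmetric])
  then show ?thesis
    using iexp_approx1[of "x - y" 0] by (simp add: norm_mult)
qed

lemma norm_integral_le_integral:
  fixes f :: "'a \<Rightarrow> 'b :: {banach, second_countable_topology}"
  assumes "integrable M f" "integrable M g" "\<And>x. x \<in> space M \<Longrightarrow> norm (f x) \<le> g x"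
  shows "norm (integral\<^sup>L M f) \<le> integral\<^sup>L M g"
  using assms by (intro order_trans[OF integral_norm_bound] integral_mono) auto

lemma borel_measurable_fst: "fst \<in> borel_measurable (borel :: ('a :: topological_space \<times> 'b :: topological_space) measure)"
  and borel_measurable_snd: "snd \<in> borel_measurable (borel :: ('a \<times> 'b) measure)"
  by (intro borel_measurable_continuous_onI continuous_intros)+

text \<open>\<open>X j\<close> and \<open>Y j\<close> model the increments of N and L over the j-th
  cell of a grid. Only the pairs are independent of each other: within one step \<open>X j\<close>
  and \<open>Y j\<close> may be dependent, as they are when N and L jump together.\<close>

locale iid_steps = prob_space M for M :: "'a measure" +
  fixes X Y :: "nat \<Rightarrow> 'a \<Rightarrow> real" and c :: real
  assumes c_gt_1: "c > 1"
    and indep: "indep_vars (\<lambda>_. borel) (\<lambda>j \<omega>. (X j \<omega>, Y j \<omega>)) UNIV"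
    and ident: "distr M borel (\<lambda>\<omega>. (X j \<omega>, Y j \<omega>)) = distr M borel (\<lambda>\<omega>. (X 0 \<omega>, Y 0 \<omega>))"
begin

lemma measurable_step [measurable]: "(\<lambda>\<omega>. (X j \<omega>, Y j \<omega>)) \<in> borel_measurable M"
  using indep by (auto simp: indep_vars_def)

lemma measurable_X [measurable]: "X j \<in> borel_measurable M"
  using measurable_comp[OF measurable_step[of j] borel_measurable_fst] by (simp add: comp_def)

lemma measurable_Y [measurable]: "Y j \<in> borel_measurable M"
  using measurable_comp[OF measurable_step[of j] borel_measurable_snd] by (simp add: comp_def)

lemma step_expectation:
  fixes f :: "real \<times> real \<Rightarrow> 'b :: {banach, second_countable_topology}"
  assumes [measurable]: "f \<in> borel_measurable borel"
  shows "expectation (\<lambda>\<omega>. f (X j \<omega>, Y j \<omega>)) = expectation (\<lambda>\<omega>. f (X 0 \<omega>, Y 0 \<omega>))"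
  using ident[of j] integral_distr[OF measurable_step[of j] assms]
    integral_distr[OF measurable_step[of 0] assms] by simp

lemma step_integrable:
  fixes f :: "real \<times> real \<Rightarrow> 'b :: {banach, second_countable_topology}"
  assumes [measurable]: "f \<in> borel_measurable borel"
  shows "integrable M (\<lambda>\<omega>. f (X j \<omega>, Y j \<omega>)) \<longleftrightarrow> integrable M (\<lambda>\<omega>. f (X 0 \<omega>, Y 0 \<omega>))"
  using ident[of j] integrable_distr_eq[OF measurable_step[of j] assms]
    integrable_distr_eq[OF measurable_step[of 0] assms] by simp

text \<open>Three instances are used: f = c^(-X) with g = Y gives the moments of the weighted sum,
  the "stay" and "jump" integrands give the law of the stopped sum, and the indicator of X = 0 with
  g = 1 gives the tail of the stopping index.\<close>

lemma
  fixes f g :: "real \<times> real \<Rightarrow> 'b :: {banach, second_countable_topology, real_normed_field}"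
  assumes f [measurable]: "f \<in> borel_measurable borel" and g [measurable]: "g \<in> borel_measurable borel"
    and "integrable M (\<lambda>\<omega>. f (X 0 \<omega>, Y 0 \<omega>))" "integrable M (\<lambda>\<omega>. g (X 0 \<omega>, Y 0 \<omega>))"
  shows integrable_step_prod: "integrable M (\<lambda>\<omega>. (\<Prod>i<n. f (X i \<omega>, Y i \<omega>)) * g (X n \<omega>, Y n \<omega>))"
    and expectation_step_prod: "expectation (\<lambda>\<omega>. (\<Prod>i<n. f (X i \<omega>, Y i \<omega>)) * g (X n \<omega>, Y n \<omega>))
      = expectation (\<lambda>\<omega>. f (X 0 \<omega>, Y 0 \<omega>)) ^ n * expectation (\<lambda>\<omega>. g (X 0 \<omega>, Y 0 \<omega>))"
proof -
  define h where "h i = (if i < n then f else g)" for i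
  have h [measurable]: "h i \<in> borel_measurable borel" for i
    by (simp add: h_def)
  have ind: "indep_vars (\<lambda>_. borel) (\<lambda>i \<omega>. h i (X i \<omega>, Y i \<omega>)) {..<Suc n}"
    by (rule indep_vars_compose2[OF indep_vars_subset[OF indep]]) auto
  have int: "integrable M (\<lambda>\<omega>. h i (X i \<omega>, Y i \<omega>))" for i
    using assms step_integrable[of f i] step_integrable[of g i] by (simp add: h_def)
  have eq: "(\<Prod>i<Suc n. h i (X i \<omega>, Y i \<omega>)) = (\<Prod>i<n. f (X i \<omega>, Y i \<omega>)) * g (X n \<omega>, Y n \<omega>)" for \<omega>
    by (simp add: h_def)
  show "integrable M (\<lambda>\<omega>. (\<Prod>i<n. f (X i \<omega>, Y i \<omega>)) * g (X n \<omega>, Y n \<omega>))"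
    using indep_vars_integrable[OF _ ind int] by (simp add: eq del: prod.lessThan_Suc)
  have "expectation (\<lambda>\<omega>. h i (X i \<omega>, Y i \<omega>)) =
     (if i < n then expectation (\<lambda>\<omega>. f (X 0 \<omega>, Y 0 \<omega>)) else expectation (\<lambda>\<omega>. g (X 0 \<omega>, Y 0 \<omega>)))" for i
    using step_expectation[OF f, of i] step_expectation[OF g, of i] by (simp add: h_def)
  then show "expectation (\<lambda>\<omega>. (\<Prod>i<n. f (X i \<omega>, Y i \<omega>)) * g (X n \<omega>, Y n \<omega>))
      = expectation (\<lambda>\<omega>. f (X 0 \<omega>, Y 0 \<omega>)) ^ n * expectation (\<lambda>\<omega>. g (X 0 \<omega>, Y 0 \<omega>))"
    using indep_vars_lebesgue_integral[OF _ ind int] by (simp add: eq del: prod.lessThan_Suc) simp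
qed

section \<open>Weighted sums and the first-step recursion for their characteristic functions\<close>

text \<open>The weight of \<open>Y (s + j)\<close> uses only the steps before it, as in a left
  Riemann sum, so it is independent of \<open>Y (s + j)\<close>. The offset \<open>s\<close> lets
  the sum restart after its first step.\<close>

definition weighted_sum :: "nat \<Rightarrow> nat \<Rightarrow> 'a \<Rightarrow> real" where
  "weighted_sum s n \<omega> = (\<Sum>j<n. c powr (- (\<Sum>i<j. X (s + i) \<omega>)) * Y (s + j) \<omega>)"

lemma measurable_weighted_sum [measurable]: "weighted_sum s n \<in> borel_measurable M"
  unfolding weighted_sum_def by measurable

text \<open>Splitting off the first step instead of the last exposes the self-similarity: what
  remains is the same functional of the later steps, scaled by c^(-X).\<close>

lemma weighted_sum_Suc:
  "weighted_sum s (Suc n) \<omega> = Y s \<omega> + c powr (- X s \<omega>) * weighted_sum (Suc s) n \<omega>"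
  using c_gt_1
  by (simp add: weighted_sum_def sum.lessThan_Suc_shift sum_distrib_left powr_add[symmetric] powr_diff
     mult.assoc[symmetric] del: sum.lessThan_Suc)

lemma measurable_first_step:
  "(\<lambda>x. iexp (z * snd x) * char (distr M borel (weighted_sum s n)) (z * c powr (- fst x)))
    \<in> borel_measurable (borel :: (real \<times> real) measure)"
proof -
  interpret Q: real_distribution "distr M borel (weighted_sum s n)" by simp
  show ?thesis
    by (intro borel_measurable_times measurable_compose[OF _ Q.char_measurable]
      borel_measurable_continuous_onI continuous_intros) (use c_gt_1 in auto)
qed

text \<open>
  \<^const>\<open>prob_space.indep_var\<close> relates variables of one type only, hence the dummy component \<open>0\<close>.
\<close>

lemma indep_first_step:
  "indep_var borel (\<lambda>\<omega>. (X s \<omega>, Y s \<omega>)) borel (\<lambda>\<omega>. (0, weighted_sum (Suc s) n \<omega>))"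
proof -
  let ?A = "{s}" and ?B = "{Suc s..<Suc s + n}"
  let ?P = "PiM ?B (\<lambda>_. borel :: (real \<times> real) measure)"
  define G :: "(nat \<Rightarrow> real \<times> real) \<Rightarrow> real \<times> real"
    where "G f = (0, \<Sum>j<n. c powr (- (\<Sum>i<j. fst (f (Suc s + i)))) * snd (f (Suc s + j)))" for f
  have "indep_var (PiM ?A (\<lambda>_. borel)) (\<lambda>\<omega>. restrict (\<lambda>j. (X j \<omega>, Y j \<omega>)) ?A)
      ?P (\<lambda>\<omega>. restrict (\<lambda>j. (X j \<omega>, Y j \<omega>)) ?B)"
    by (rule indep_var_restrict[OF indep]) auto
  then have "indep_var borel ((\<lambda>f. f s) \<circ> (\<lambda>\<omega>. restrict (\<lambda>j. (X j \<omega>, Y j \<omega>)) ?A)) borel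
     (G \<circ> (\<lambda>\<omega>. restrict (\<lambda>j. (X j \<omega>, Y j \<omega>)) ?B))"
  proof (rule indep_var_compose)
    have f: "(\<lambda>f. f (Suc s + j)) \<in> borel_measurable ?P" if "j < n" for j
      by (rule measurable_component_singleton) (use that in auto)
    have "(\<lambda>f. fst (f (Suc s + j))) \<in> borel_measurable ?P" "(\<lambda>f. snd (f (Suc s + j))) \<in> borel_measurable ?P"
      if "j < n" for j
      using measurable_comp[OF f[OF that] borel_measurable_fst] measurable_comp[OF f[OF that] borel_measurable_snd]
      by (simp_all add: comp_def)
    then show "G \<in> borel_measurable ?P"
      unfolding G_def
      by (intro borel_measurable_Pair borel_measurable_sum borel_measurable_times borel_measurable_uminus
        powr_real_measurable borel_measurable_const) auto
  qed auto
  also have "(\<lambda>f. f s) \<circ> (\<lambda>\<omega>. restrict (\<lambda>j. (X j \<omega>, Y j \<omega>)) ?A) = (\<lambda>\<omega>. (X s \<omega>, Y s \<omega>))"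
    by auto
  also have "G \<circ> (\<lambda>\<omega>. restrict (\<lambda>j. (X j \<omega>, Y j \<omega>)) ?B) = (\<lambda>\<omega>. (0, weighted_sum (Suc s) n \<omega>))"
    by (auto simp: G_def fun_eq_iff weighted_sum_def intro!: sum.cong arg_cong2[where f="(*)"] arg_cong[where f="\<lambda>x. c powr - x"])
  finally show ?thesis .
qed

text \<open>By independence the joint law of the first step and the tail is a product. Fubini
  integrates the tail out first, and the factor c^(-X) passes into the argument of its
  characteristic function.\<close>

lemma char_weighted_sum_first_step:
  "char (distr M borel (weighted_sum s (Suc n))) z =
    expectation (\<lambda>\<omega>. iexp (z * Y s \<omega>) * char (distr M borel (weighted_sum (Suc s) n)) (z * c powr (- X s \<omega>)))"
proof -
  let ?W = "weighted_sum (Suc s) n" and ?S = "\<lambda>\<omega>. (X s \<omega>, Y s \<omega>)"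
  let ?P = "distr M borel ?S" and ?Q = "distr M borel (\<lambda>\<omega>. (0 :: real, ?W \<omega>))"
  let ?C = "char (distr M borel ?W)"
  interpret P: prob_space ?P by (rule prob_space_distr) simp
  interpret Q: prob_space ?Q by (rule prob_space_distr) simp
  interpret PQ: pair_prob_space ?P ?Q ..
  have eq: "?P \<Otimes>\<^sub>M ?Q = distr M (borel \<Otimes>\<^sub>M borel) (\<lambda>\<omega>. (?S \<omega>, (0, ?W \<omega>)))"
    using indep_first_step[of s n] unfolding indep_var_distribution_eq by blast
  define F :: "(real \<times> real) \<times> (real \<times> real) \<Rightarrow> complex"
    where "F p = iexp (z * (snd (fst p) + c powr (- fst (fst p)) * snd (snd p)))" for p
  have F: "F \<in> borel_measurable (borel \<Otimes>\<^sub>M borel)"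
    unfolding F_def borel_prod by (intro borel_measurable_continuous_onI continuous_intros) (use c_gt_1 in auto)
  have F': "F \<in> borel_measurable (?P \<Otimes>\<^sub>M ?Q)"
  proof -
    have "sets (?P \<Otimes>\<^sub>M ?Q) = sets (borel \<Otimes>\<^sub>M borel)"
      by (intro sets_pair_measure_cong sets_distr)
    then show ?thesis
      using F unfolding measurable_cong_sets[OF \<open>sets _ = _\<close> refl] by simp
  qed
  have int: "integrable (?P \<Otimes>\<^sub>M ?Q) F"
    by (rule PQ.integrable_const_bound[where B=1, OF _ F']) (simp add: F_def del: of_real_mult of_real_add)
  have inner: "(\<integral>y. F (x, y) \<partial>?Q) = iexp (z * snd x) * ?C (z * c powr (- fst x))" for x
  proof -
    have "F (x, y) = iexp (z * snd x) * iexp (z * c powr (- fst x) * snd y)" for y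
      unfolding exp_add[symmetric] by (simp add: F_def algebra_simps)
    then have "(\<integral>y. F (x, y) \<partial>?Q) = (\<integral>y. iexp (z * snd x) * iexp (z * c powr (- fst x) * snd y) \<partial>?Q)"
      by (simp only:)
    also have "\<dots> = expectation (\<lambda>\<omega>. iexp (z * snd x) * iexp (z * c powr (- fst x) * ?W \<omega>))"
    proof -
      have "(\<lambda>y. iexp (z * snd x) * iexp (z * c powr (- fst x) * snd y)) \<in> borel_measurable (borel :: (real \<times> real) measure)"
        by (intro borel_measurable_continuous_onI continuous_intros)
      from integral_distr[OF _ this, of "\<lambda>\<omega>. (0, ?W \<omega>)" M] show ?thesis
        by simp
    qed
    also have "\<dots> = iexp (z * snd x) * ?C (z * c powr (- fst x))"
      unfolding char_def by (subst integral_distr) auto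
    finally show ?thesis .
  qed
  have "char (distr M borel (weighted_sum s (Suc n))) z = expectation (\<lambda>\<omega>. F (?S \<omega>, (0, ?W \<omega>)))"
    unfolding char_def by (subst integral_distr) (auto simp: F_def weighted_sum_Suc)
  also have "\<dots> = integral\<^sup>L (?P \<Otimes>\<^sub>M ?Q) F"
    unfolding eq by (subst integral_distr) (auto simp: F)
  also have "\<dots> = (\<integral>x. (\<integral>y. F (x, y) \<partial>?Q) \<partial>?P)"
    using PQ.integral_fst'[OF int] by simp
  also have "\<dots> = (\<integral>x. iexp (z * snd x) * ?C (z * c powr (- fst x)) \<partial>?P)"
    unfolding inner ..
  also have "\<dots> = expectation (\<lambda>\<omega>. iexp (z * Y s \<omega>) * ?C (z * c powr (- X s \<omega>)))"
    using measurable_first_step by (subst integral_distr) auto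
  finally show ?thesis .
qed

text \<open>The steps are identically distributed, so the starting index does not affect the law.
  This closes the recursion, whose right-hand side starts one step later.\<close>

lemma char_weighted_sum_shift:
  "char (distr M borel (weighted_sum s n)) z = char (distr M borel (weighted_sum 0 n)) z"
proof (induction n arbitrary: s z)
  case 0
  then show ?case by (simp add: weighted_sum_def)
next
  case (Suc n)
  show ?case
    unfolding char_weighted_sum_first_step Suc.IH[of "Suc _"]
    using step_expectation[OF measurable_first_step[of z 0 n], of s] by simp
qed

text \<open>\<open>char_stay\<close> and \<open>char_jump\<close> are the functions a and b of the
  introduction. They add up to the characteristic function of \<open>Y 0\<close>.\<close>

definition char_stay :: "real \<Rightarrow> complex" where
  "char_stay z = expectation (\<lambda>\<omega>. iexp (z * Y 0 \<omega>) * indicator {0} (X 0 \<omega>))"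
definition char_jump :: "real \<Rightarrow> complex" where
  "char_jump z = expectation (\<lambda>\<omega>. iexp (z * Y 0 \<omega>) * indicator (- {0}) (X 0 \<omega>))"

lemma integrable_iexp_mult:
  assumes [measurable]: "f \<in> borel_measurable M" "g \<in> borel_measurable M" and "\<And>\<omega>. norm (g \<omega>) \<le> B"
  shows "integrable M (\<lambda>\<omega>. iexp (f \<omega>) * (g \<omega> :: complex))"
  by (rule integrable_const_bound[where B=B]) (use assms in \<open>auto simp: norm_mult\<close>)

text \<open>On \<open>X 0 = 0\<close> the inner argument in the first-step formula is z and on
  \<open>X 0 = 1\<close> it is z / c, so there the recursion is exact. Elsewhere two values of a
  characteristic function are interchanged, at a cost of at most 2.\<close>

lemma char_weighted_sum_Suc_approx:
  fixes z :: real
  defines "\<phi> n \<equiv> char (distr M borel (weighted_sum 0 n))"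
  shows "cmod (\<phi> (Suc n) z - char_stay z * \<phi> n z - char_jump z * \<phi> n (z / c)) \<le> 2 * prob {\<omega> \<in> space M. X 0 \<omega> \<notin> {0, 1}}"
proof -
  interpret Q: real_distribution "distr M borel (weighted_sum 0 n)" by simp
  have [measurable]: "\<phi> n \<in> borel_measurable borel" and le1: "cmod (\<phi> n x) \<le> 1" for x
    unfolding \<phi>_def by (rule Q.char_measurable, rule Q.cmod_char_le_1)
  have le2: "cmod (\<phi> n x - \<phi> n y) \<le> 2" for x y
    using norm_triangle_ineq4[of "\<phi> n x" "\<phi> n y"] le1[of x] le1[of y] by linarith
  define E where "E \<omega> = iexp (z * Y 0 \<omega>) * (\<phi> n (z * c powr (- X 0 \<omega>)) - indicator {0} (X 0 \<omega>) * \<phi> n z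
     - indicator (- {0}) (X 0 \<omega>) * \<phi> n (z / c))" for \<omega>
  have E: "E \<omega> = iexp (z * Y 0 \<omega>) * \<phi> n (z * c powr (- X 0 \<omega>))
     - iexp (z * Y 0 \<omega>) * indicator {0} (X 0 \<omega>) * \<phi> n z
     - iexp (z * Y 0 \<omega>) * indicator (- {0}) (X 0 \<omega>) * \<phi> n (z / c)" for \<omega>
    by (simp add: E_def algebra_simps)
  have [measurable]: "(\<lambda>\<omega>. \<phi> n (z * c powr (- X 0 \<omega>))) \<in> borel_measurable M"
    by measurable
  have "integrable M (\<lambda>\<omega>. iexp (z * Y 0 \<omega>) * \<phi> n (z * c powr (- X 0 \<omega>)))"
    "integrable M (\<lambda>\<omega>. iexp (z * Y 0 \<omega>) * indicator {0} (X 0 \<omega>))"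
    "integrable M (\<lambda>\<omega>. iexp (z * Y 0 \<omega>) * indicator (- {0}) (X 0 \<omega>))"
    by (rule integrable_iexp_mult[where B=1]; auto simp: le1 split: split_indicator)+
  then have "\<phi> (Suc n) z - char_stay z * \<phi> n z - char_jump z * \<phi> n (z / c) = expectation E"
    unfolding E
    by (simp add: char_stay_def char_jump_def \<phi>_def char_weighted_sum_first_step char_weighted_sum_shift[of "Suc 0"])
  also have "cmod \<dots> \<le> expectation (\<lambda>\<omega>. 2 * indicator {\<omega> \<in> space M. X 0 \<omega> \<notin> {0, 1}} \<omega>)"
  proof (rule norm_integral_le_integral)
    show "integrable M E"
      unfolding E_def
    \<comment> \<open>Exactly one indicator is 1, so the bracket is a difference of two
      characteristic function values, of modulus at most 2. The constant serves integrability
      alone.\<close>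
    proof (rule integrable_iexp_mult[where B=3])
      show "cmod (\<phi> n (z * c powr (- X 0 \<omega>)) - indicator {0} (X 0 \<omega>) * \<phi> n z
        - indicator (- {0}) (X 0 \<omega>) * \<phi> n (z / c)) \<le> 3" for \<omega>
        using le2[of "z * c powr (- X 0 \<omega>)" z] le2[of "z * c powr (- X 0 \<omega>)" "z / c"]
        by (auto split: split_indicator)
    qed auto
    show "norm (E \<omega>) \<le> 2 * indicator {\<omega> \<in> space M. X 0 \<omega> \<notin> {0, 1}} \<omega>" if "\<omega> \<in> space M" for \<omega>
      using le2[of "z * c powr (- X 0 \<omega>)" z] le2[of "z * c powr (- X 0 \<omega>)" "z / c"] that c_gt_1
      by (auto simp: E_def norm_mult powr_minus divide_inverse split: split_indicator)
  qed (auto intro!: integrable_const_bound[where B=1])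
  also have "\<dots> = 2 * prob {\<omega> \<in> space M. X 0 \<omega> \<notin> {0, 1}}"
    by simp
  finally show ?thesis .
qed

text \<open>The weight is a product of n i.i.d. factors c^(-X), independent of \<open>Y n\<close>,
  so the moments decay geometrically in n.\<close>

lemma
  assumes "integrable M (\<lambda>\<omega>. c powr (- X 0 \<omega>))" "integrable M (Y 0)"
  shows integrable_weighted_step: "integrable M (\<lambda>\<omega>. c powr (- (\<Sum>i<n. X i \<omega>)) * Y n \<omega>)"
    and expectation_weighted_step: "expectation (\<lambda>\<omega>. c powr (- (\<Sum>i<n. X i \<omega>)) * Y n \<omega>)
      = expectation (\<lambda>\<omega>. c powr (- X 0 \<omega>)) ^ n * expectation (Y 0)"
    and expectation_abs_weighted_step: "expectation (\<lambda>\<omega>. \<bar>c powr (- (\<Sum>i<n. X i \<omega>)) * Y n \<omega>\<bar>)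
      = expectation (\<lambda>\<omega>. c powr (- X 0 \<omega>)) ^ n * expectation (\<lambda>\<omega>. \<bar>Y 0 \<omega>\<bar>)"
proof -
  have eq: "c powr (- (\<Sum>i<n. X i \<omega>)) = (\<Prod>i<n. c powr (- X i \<omega>))" for \<omega>
    using c_gt_1 by (simp add: powr_sum[symmetric] sum_negf)
  have m: "(\<lambda>x. c powr (- fst x)) \<in> borel_measurable (borel :: (real \<times> real) measure)"
    "snd \<in> borel_measurable (borel :: (real \<times> real) measure)"
    "(\<lambda>x. \<bar>snd x\<bar>) \<in> borel_measurable (borel :: (real \<times> real) measure)"
    using c_gt_1 by (auto intro!: borel_measurable_continuous_onI continuous_intros)
  show "integrable M (\<lambda>\<omega>. c powr (- (\<Sum>i<n. X i \<omega>)) * Y n \<omega>)"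
    "expectation (\<lambda>\<omega>. c powr (- (\<Sum>i<n. X i \<omega>)) * Y n \<omega>)
      = expectation (\<lambda>\<omega>. c powr (- X 0 \<omega>)) ^ n * expectation (Y 0)"
    using integrable_step_prod[OF m(1,2), of n] expectation_step_prod[OF m(1,2), of n] assms by (simp_all add: eq)
  show "expectation (\<lambda>\<omega>. \<bar>c powr (- (\<Sum>i<n. X i \<omega>)) * Y n \<omega>\<bar>)
      = expectation (\<lambda>\<omega>. c powr (- X 0 \<omega>)) ^ n * expectation (\<lambda>\<omega>. \<bar>Y 0 \<omega>\<bar>)"
    using expectation_step_prod[OF m(1,3), of n] assms by (simp add: eq abs_mult prod_nonneg)
qed

lemma expectation_weighted_sum:
  assumes "integrable M (\<lambda>\<omega>. c powr (- X 0 \<omega>))" "integrable M (Y 0)"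
  shows "expectation (weighted_sum 0 n) = (\<Sum>j<n. expectation (\<lambda>\<omega>. c powr (- X 0 \<omega>)) ^ j) * expectation (Y 0)"
  unfolding weighted_sum_def
  using integrable_weighted_step[OF assms] expectation_weighted_step[OF assms]
  by (simp add: sum_distrib_right)

text \<open>The map x to exp(i z x) is Lipschitz with constant |z|, so the difference is controlled
  by the mean modulus of the last summand.\<close>

lemma char_weighted_sum_increment:
  assumes "integrable M (\<lambda>\<omega>. c powr (- X 0 \<omega>))" "integrable M (Y 0)"
  shows "cmod (char (distr M borel (weighted_sum 0 (Suc n))) z - char (distr M borel (weighted_sum 0 n)) z)
    \<le> \<bar>z\<bar> * (expectation (\<lambda>\<omega>. c powr (- X 0 \<omega>)) ^ n * expectation (\<lambda>\<omega>. \<bar>Y 0 \<omega>\<bar>))"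
proof -
  let ?d = "\<lambda>\<omega>. c powr (- (\<Sum>i<n. X i \<omega>)) * Y n \<omega>"
  have i: "integrable M (\<lambda>\<omega>. iexp (z * weighted_sum 0 m \<omega>))" for m
    by (rule integrable_iexp) auto
  have "char (distr M borel (weighted_sum 0 (Suc n))) z - char (distr M borel (weighted_sum 0 n)) z
    = expectation (\<lambda>\<omega>. iexp (z * weighted_sum 0 (Suc n) \<omega>) - iexp (z * weighted_sum 0 n \<omega>))"
    using i[of n] i[of "Suc n"] by (simp add: char_def integral_distr)
  also have "cmod \<dots> \<le> expectation (\<lambda>\<omega>. \<bar>z\<bar> * \<bar>?d \<omega>\<bar>)"
  proof (rule norm_integral_le_integral)
    show "cmod (iexp (z * weighted_sum 0 (Suc n) \<omega>) - iexp (z * weighted_sum 0 n \<omega>)) \<le> \<bar>z\<bar> * \<bar>?d \<omega>\<bar>" for \<omega>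
      using norm_iexp_diff_le[of "z * weighted_sum 0 (Suc n) \<omega>" "z * weighted_sum 0 n \<omega>"]
      by (simp add: weighted_sum_def algebra_simps abs_mult)
  qed (use i[of n] i[of "Suc n"] integrable_weighted_step[OF assms, of n] in auto)
  finally show ?thesis
    using expectation_abs_weighted_step[OF assms, of n] by simp
qed

section \<open>The sum stopped at the first jump\<close>

text \<open>The step carrying the first nonzero X is included. On the grid the sum therefore
  telescopes to L at the right end of the cell in which N first moves. Where every X vanishes the
  index is unspecified.\<close>

definition stopped_sum :: "'a \<Rightarrow> real" where
  "stopped_sum \<omega> = (\<Sum>i\<le>(LEAST j. X j \<omega> \<noteq> 0). Y i \<omega>)"

lemma measurable_stopped_sum [measurable]: "stopped_sum \<in> borel_measurable M"
proof -
  have "(\<lambda>\<omega>. LEAST j. X j \<omega> \<noteq> 0) \<in> measurable M (count_space UNIV)"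
    by measurable
  then show ?thesis
    unfolding stopped_sum_def
    by (rule measurable_compose_countable[rotated]) (intro borel_measurable_sum measurable_Y)
qed

text \<open>This keeps 1 - a away from 0: its modulus is at least the probability that N moves in
  one step.\<close>

lemma cmod_char_stay_le: "cmod (char_stay z) \<le> 1 - prob {\<omega> \<in> space M. X 0 \<omega> \<noteq> 0}"
proof -
  have "cmod (char_stay z) \<le> expectation (\<lambda>\<omega>. indicator {\<omega> \<in> space M. X 0 \<omega> = 0} \<omega>)"
    unfolding char_stay_def
    by (rule norm_integral_le_integral)
       (auto intro!: integrable_const_bound[where B=1] simp: norm_mult split: split_indicator)
  also have "\<dots> = 1 - prob {\<omega> \<in> space M. X 0 \<omega> \<noteq> 0}"
    by (subst prob_neg[symmetric]) auto
  finally show ?thesis .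
qed

text \<open>Let D n be the expectation of exp(i z S) over the event that the first n steps have X =
  0, where S is the stopped sum. The difference D n - D (n + 1) isolates a first jump at step n and
  equals a^n b. As D n tends to 0, telescoping against the geometric series gives D 0 = b / (1 -
  a).\<close>

lemma char_stopped_sum:
  assumes "prob {\<omega> \<in> space M. X 0 \<omega> \<noteq> 0} > 0"
  shows "char (distr M borel stopped_sum) z * (1 - char_stay z) = char_jump z"
proof -
  let ?p = "prob {\<omega> \<in> space M. X 0 \<omega> \<noteq> 0}"
  define D where "D n = expectation (\<lambda>\<omega>. (\<Prod>i<n. indicator {0} (X i \<omega>)) * iexp (z * stopped_sum \<omega>))" for n
  have m: "(\<lambda>x. iexp (z * snd x) * indicator {0} (fst x)) \<in> borel_measurable (borel :: (real \<times> real) measure)"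
    "(\<lambda>x. iexp (z * snd x) * indicator (- {0}) (fst x)) \<in> borel_measurable (borel :: (real \<times> real) measure)"
    by (auto simp: borel_prod[symmetric])
  have i: "integrable M (\<lambda>\<omega>. iexp (z * Y 0 \<omega>) * indicator {0} (X 0 \<omega>))"
    "integrable M (\<lambda>\<omega>. iexp (z * Y 0 \<omega>) * indicator (- {0}) (X 0 \<omega>))"
    by (rule integrable_iexp_mult[where B=1]; auto split: split_indicator)+
  have iD: "integrable M (\<lambda>\<omega>. (\<Prod>i<n. indicator {0} (X i \<omega>)) * iexp (z * stopped_sum \<omega>))" for n
  proof (rule integrable_const_bound[where B=1])
    have "cmod (indicator {0} x) \<le> 1" for x :: real
      by (simp split: split_indicator)
    then show "AE \<omega> in M. cmod ((\<Prod>i<n. indicator {0} (X i \<omega>)) * iexp (z * stopped_sum \<omega>)) \<le> 1"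
      by (auto simp: norm_mult simp flip: prod_norm intro!: prod_le_1)
  qed measurable
  have D_diff: "D n - D (Suc n) = char_stay z ^ n * char_jump z" for n
  proof -
    have "D n - D (Suc n) = expectation (\<lambda>\<omega>. (\<Prod>i<n. iexp (z * Y i \<omega>) * indicator {0} (X i \<omega>)) *
      (iexp (z * Y n \<omega>) * indicator (- {0}) (X n \<omega>)))"
      unfolding D_def
    proof (subst Bochner_Integration.integral_diff[symmetric, OF iD iD], intro Bochner_Integration.integral_cong refl)
      fix \<omega>
      show "(\<Prod>i<n. indicator {0} (X i \<omega>)) * iexp (z * stopped_sum \<omega>) -
          (\<Prod>i<Suc n. indicator {0} (X i \<omega>)) * iexp (z * stopped_sum \<omega>) =
        (\<Prod>i<n. iexp (z * Y i \<omega>) * indicator {0} (X i \<omega>)) * (iexp (z * Y n \<omega>) * indicator (- {0}) (X n \<omega>))"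
      \<comment> \<open>If the first nonzero X is at n, S is the sum of Y over indices up to n and
        the exponential factors. Otherwise both sides are 0: either an earlier X is nonzero, or X n
        = 0 and the two products on the left agree.\<close>
      proof (cases "(\<forall>i<n. X i \<omega> = 0) \<and> X n \<omega> \<noteq> 0")
        case True
        then have "(LEAST j. X j \<omega> \<noteq> 0) = n"
          by (intro Least_equality) (auto simp: not_le[symmetric])
        then have "stopped_sum \<omega> = (\<Sum>i<n. Y i \<omega>) + Y n \<omega>"
          by (simp add: stopped_sum_def lessThan_Suc_atMost[symmetric])
        then show ?thesis
          using True by (simp add: exp_add exp_sum sum_distrib_left distrib_left)
      next
        case False
        show ?thesis
        proof (cases "\<forall>i<n. X i \<omega> = 0")
          case True
          with False show ?thesis by (simp add: indicator_def)
        next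
          case no: False
          then have "(\<Prod>i<n. indicator {0} (X i \<omega>) :: complex) = 0"
            "(\<Prod>i<n. iexp (z * Y i \<omega>) * indicator {0} (X i \<omega>)) = 0"
            by (auto simp: indicator_def)
          then show ?thesis by (simp only: prod.lessThan_Suc mult_zero_left diff_self)
        qed
      qed
    qed
    also have "\<dots> = char_stay z ^ n * char_jump z"
      using expectation_step_prod[OF m, of n] i by (simp add: char_stay_def char_jump_def)
    finally show ?thesis .
  qed
  \<comment> \<open>The event in D n has probability (1 - p)^n and the exponential has modulus 1, so
    the unspecified value of S on paths without jump does no harm.\<close>
  have D_le: "cmod (D n) \<le> (1 - ?p) ^ n" for n
  proof -
    have m: "(\<lambda>x. indicator {0} (fst x)) \<in> borel_measurable (borel :: (real \<times> real) measure)"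
      by (auto simp: borel_prod[symmetric])
    have "cmod (D n) \<le> expectation (\<lambda>\<omega>. (\<Prod>i<n. indicator {0} (X i \<omega>)) * 1)"
      unfolding D_def
    proof (rule norm_integral_le_integral[OF iD])
      show "integrable M (\<lambda>\<omega>. (\<Prod>i<n. indicator {0} (X i \<omega>)) * 1 :: real)"
        by (rule integrable_const_bound[where B=1])
           (auto simp: abs_prod intro!: prod_le_1 split: split_indicator)
      show "cmod ((\<Prod>i<n. indicator {0} (X i \<omega>)) * iexp (z * stopped_sum \<omega>))
          \<le> (\<Prod>i<n. indicator {0} (X i \<omega>)) * 1" for \<omega>
      proof -
        have "cmod (indicator {0} x) = indicator {0} x" for x :: real
          by (simp split: split_indicator)
        then show ?thesis by (simp add: norm_mult prod_norm[symmetric])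
      qed
    qed
    also have "\<dots> = expectation (\<lambda>\<omega>. indicator {0} (X 0 \<omega>)) ^ n"
    proof -
      have "integrable M (\<lambda>\<omega>. indicator {0} (X 0 \<omega>) :: real)"
        by (rule integrable_const_bound[where B=1]) (auto split: split_indicator)
      then show ?thesis
        using expectation_step_prod[OF m borel_measurable_const, of 1 n] by (simp add: prob_space)
    qed
    also have "expectation (\<lambda>\<omega>. indicator {0} (X 0 \<omega>)) = expectation (\<lambda>\<omega>. indicator {\<omega> \<in> space M. X 0 \<omega> = 0} \<omega>)"
      by (intro Bochner_Integration.integral_cong) (auto split: split_indicator)
    also have "\<dots> = 1 - ?p"
      by (subst prob_neg[symmetric]) auto
    finally show ?thesis .
  qed
  have a: "cmod (char_stay z) < 1"
    using cmod_char_stay_le[of z] assms by linarith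
  have p1: "?p \<le> 1" by simp
  have "D \<longlonglongrightarrow> 0"
    using assms p1 by (intro Lim_null_comparison[OF _ LIMSEQ_power_zero[of "1 - ?p"]]) (auto simp: D_le)
  then have "(\<lambda>n. D n - D (Suc n)) sums (D 0 - 0)"
    by (rule telescope_sums')
  then have "(\<lambda>n. char_stay z ^ n * char_jump z) sums D 0"
    by (simp add: D_diff)
  moreover have "(\<lambda>n. char_stay z ^ n * char_jump z) sums (1 / (1 - char_stay z) * char_jump z)"
    by (intro sums_mult2 geometric_sums a)
  ultimately have "D 0 = 1 / (1 - char_stay z) * char_jump z"
    by (rule sums_unique2)
  moreover have "1 - char_stay z \<noteq> 0"
    using a by auto
  moreover have "D 0 = char (distr M borel stopped_sum) z"
    by (simp add: D_def char_def integral_distr)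
  ultimately show ?thesis
    by (simp add: field_simps)
qed

text \<open>Multiplying the difference by 1 - a, of modulus at least the probability of a move, and
  using psi (1 - a) = b turns it into the defect of the recursion minus the increment from n to n +
  1. Both have been estimated.\<close>

lemma char_weighted_sum_approx:
  assumes "integrable M (\<lambda>\<omega>. c powr (- X 0 \<omega>))" "integrable M (Y 0)"
  shows "cmod (char (distr M borel (weighted_sum 0 n)) z -
      char (distr M borel stopped_sum) z * char (distr M borel (weighted_sum 0 n)) (z / c))
        * prob {\<omega> \<in> space M. X 0 \<omega> \<noteq> 0}
    \<le> 2 * prob {\<omega> \<in> space M. X 0 \<omega> \<notin> {0, 1}}
      + \<bar>z\<bar> * (expectation (\<lambda>\<omega>. c powr (- X 0 \<omega>)) ^ n * expectation (\<lambda>\<omega>. \<bar>Y 0 \<omega>\<bar>))"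
    (is "cmod (?\<phi> n z - ?\<psi> * ?\<phi> n (z / c)) * ?p \<le> ?r")
\<comment> \<open>Without moves the left side is 0 and only the sign of the right side
  matters.\<close>
proof (cases "?p > 0")
  case False
  then have "?p = 0"
    by (simp add: zero_less_measure_iff)
  moreover have "0 \<le> ?r"
    by (intro add_nonneg_nonneg mult_nonneg_nonneg zero_le_power Bochner_Integration.integral_nonneg) auto
  ultimately show ?thesis by simp
next
  case True
  have "?p \<le> cmod (1 - char_stay z)"
    using cmod_char_stay_le[of z] norm_triangle_ineq2[of 1 "char_stay z"] by simp
  then have "cmod (?\<phi> n z - ?\<psi> * ?\<phi> n (z / c)) * ?p \<le> cmod ((?\<phi> n z - ?\<psi> * ?\<phi> n (z / c)) * (1 - char_stay z))"
    by (simp add: norm_mult mult_left_mono)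
  also have "(?\<phi> n z - ?\<psi> * ?\<phi> n (z / c)) * (1 - char_stay z) = ?\<phi> n z - char_stay z * ?\<phi> n z - (?\<psi> * (1 - char_stay z)) * ?\<phi> n (z / c)"
    by (simp add: algebra_simps)
  also have "\<dots> = (?\<phi> (Suc n) z - char_stay z * ?\<phi> n z - char_jump z * ?\<phi> n (z / c)) - (?\<phi> (Suc n) z - ?\<phi> n z)"
    using char_stopped_sum[OF True, of z] by simp
  also have "cmod \<dots> \<le> ?r"
    using char_weighted_sum_Suc_approx[of n z] char_weighted_sum_increment[OF assms, of n z]
    by (intro order_trans[OF norm_triangle_ineq4]) (rule add_mono)
  finally show ?thesis .
qed

end

section \<open>Paths\<close>

text \<open>The functionals in \<open>rho\<close> and \<open>mu\<close> are known to agree with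
  measurable ones only almost surely. Preimages under \<open>f\<close> differ from those under
  \<open>g\<close> by null sets, so \<open>f\<close> is measurable for the completion, and its law
  is that of \<open>g\<close> under \<open>M\<close>.\<close>

lemma distr_completion_cong_AE:
  assumes ae: "AE \<omega> in M. f \<omega> = g \<omega>" and g: "g \<in> measurable M N" and f: "\<And>\<omega>. \<omega> \<in> space M \<Longrightarrow> f \<omega> \<in> space N"
  shows "distr (completion M) N f = distr M N g"
proof -
  have sets: "f -` A \<inter> space M \<in> sets (completion M)" if A: "A \<in> sets N" for A
  proof (rule completion.in_sets_AE)
    show "AE x in completion M. x \<in> g -` A \<inter> space M \<longleftrightarrow> x \<in> f -` A \<inter> space M"
      using AE_completion[OF ae] by eventually_elim simp
  qed (use measurable_sets[OF g A] in auto)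
  then have mf: "f \<in> measurable (completion M) N"
    using f by (auto simp: measurable_def)
  have "distr (completion M) N f = distr (completion M) N g"
    using mf g ae by (intro distr_cong_AE) (auto simp: AE_completion measurable_completion)
  then show ?thesis
    using distr_completion[OF g] by simp
qed

lemma cadlag_rightD: "cadlag f \<Longrightarrow> 0 \<le> t \<Longrightarrow> (f \<longlongrightarrow> f t) (at_right t)"
  by (simp add: cadlag_def)

lemma cadlag_left_limit:
  assumes "cadlag f" "0 < t"
  shows "(f \<longlongrightarrow> left_limit f t) (at_left t)"
  using assms unfolding cadlag_def left_limit_def
  by (metis tendsto_Lim trivial_limit_at_left_real)

lemma cadlag_fst:
  assumes "cadlag h"
  shows "cadlag (\<lambda>t. fst (h t))"
  unfolding cadlag_def
proof (intro conjI allI impI)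
  fix t :: real assume "0 \<le> t"
  with assms show "((\<lambda>t. fst (h t)) \<longlongrightarrow> fst (h t)) (at_right t)"
    by (intro tendsto_fst cadlag_rightD)
next
  fix t :: real assume "0 < t"
  with assms obtain l where "(h \<longlongrightarrow> l) (at_left t)"
    unfolding cadlag_def by blast
  then show "\<exists>l. ((\<lambda>t. fst (h t)) \<longlongrightarrow> l) (at_left t)"
    by (blast intro: tendsto_fst)
qed

lemma cadlag_snd:
  assumes "cadlag h"
  shows "cadlag (\<lambda>t. snd (h t))"
  unfolding cadlag_def
proof (intro conjI allI impI)
  fix t :: real assume "0 \<le> t"
  with assms show "((\<lambda>t. snd (h t)) \<longlongrightarrow> snd (h t)) (at_right t)"
    by (intro tendsto_snd cadlag_rightD)
next
  fix t :: real assume "0 < t"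
  with assms obtain l where "(h \<longlongrightarrow> l) (at_left t)"
    unfolding cadlag_def by blast
  then show "\<exists>l. ((\<lambda>t. snd (h t)) \<longlongrightarrow> l) (at_left t)"
    by (blast intro: tendsto_snd)
qed

text \<open>The three sequences are the next grid point strictly after s, the first one at or after
  s, and the last one strictly before s. They serve right-continuity, the first jump time and left
  limits respectively.\<close>

lemma right_grid_tendsto:
  "(\<lambda>n. (of_int \<lfloor>s * real (Suc n)\<rfloor> + 1) / real (Suc n)) \<longlonglongrightarrow> s"
  "(\<lambda>n. of_int \<lceil>s * real (Suc n)\<rceil> / real (Suc n)) \<longlonglongrightarrow> s"
  "(\<lambda>n. (of_int \<lceil>s * real (Suc n)\<rceil> - 1) / real (Suc n)) \<longlonglongrightarrow> s"
proof -
  have 1: "(\<lambda>n. s + 1 / real (Suc n)) \<longlonglongrightarrow> s" "(\<lambda>n. s - 1 / real (Suc n)) \<longlonglongrightarrow> s"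
    using tendsto_add[OF tendsto_const[of s] LIMSEQ_Suc[OF lim_1_over_n]]
      tendsto_diff[OF tendsto_const[of s] LIMSEQ_Suc[OF lim_1_over_n]] by simp_all
  have b: "s \<le> (of_int \<lfloor>s * real (Suc n)\<rfloor> + 1) / real (Suc n)"
    "(of_int \<lfloor>s * real (Suc n)\<rfloor> + 1) / real (Suc n) \<le> s + 1 / real (Suc n)"
    "s \<le> of_int \<lceil>s * real (Suc n)\<rceil> / real (Suc n)"
    "of_int \<lceil>s * real (Suc n)\<rceil> / real (Suc n) \<le> s + 1 / real (Suc n)"
    "s - 1 / real (Suc n) \<le> (of_int \<lceil>s * real (Suc n)\<rceil> - 1) / real (Suc n)"
    "(of_int \<lceil>s * real (Suc n)\<rceil> - 1) / real (Suc n) \<le> s" for n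
    by (simp_all add: field_simps del: of_nat_Suc; linarith)+
  show "(\<lambda>n. (of_int \<lfloor>s * real (Suc n)\<rfloor> + 1) / real (Suc n)) \<longlonglongrightarrow> s"
    by (rule tendsto_sandwich[OF _ _ tendsto_const 1(1)]) (simp_all only: b eventually_sequentially simp_thms)
  show "(\<lambda>n. of_int \<lceil>s * real (Suc n)\<rceil> / real (Suc n)) \<longlonglongrightarrow> s"
    by (rule tendsto_sandwich[OF _ _ tendsto_const 1(1)]) (simp_all only: b eventually_sequentially simp_thms)
  show "(\<lambda>n. (of_int \<lceil>s * real (Suc n)\<rceil> - 1) / real (Suc n)) \<longlonglongrightarrow> s"
    by (rule tendsto_sandwich[OF _ _ 1(2) tendsto_const]) (simp_all only: b eventually_sequentially simp_thms)
qed

text \<open>This extends a property from countably many grid increments to all pairs of times: both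
  times are approached strictly from the right on a common grid, and the closed set retains the
  limit.\<close>

lemma cadlag_increment_mem_closed:
  fixes f :: "real \<Rightarrow> real"
  assumes "cadlag f" "closed C"
    and grid: "\<And>i j n :: nat. i \<le> j \<Longrightarrow> f (real j / real (Suc n)) - f (real i / real (Suc n)) \<in> C"
    and st: "0 \<le> s" "s \<le> t"
  shows "f t - f s \<in> C"
proof -
  define p where "p u n = (of_int \<lfloor>u * real (Suc n)\<rfloor> + 1) / real (Suc n)" for u and n :: nat
  have p: "(\<lambda>n. f (p u n)) \<longlonglongrightarrow> f u" if "0 \<le> u" for u
  proof (rule filterlim_compose[OF cadlag_rightD[OF assms(1) that]])
    have "u < p u n" for n
      unfolding p_def by (simp add: field_simps del: of_nat_Suc) linarith
    then have "\<forall>\<^sub>F n in sequentially. p u n \<in> {u<..} \<and> p u n \<noteq> u"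
      by (intro always_eventually) (auto simp: less_imp_neq[THEN not_sym])
    moreover have "p u \<longlonglongrightarrow> u"
      unfolding p_def by (rule right_grid_tendsto)
    ultimately show "filterlim (p u) (at_right u) sequentially"
      by (simp add: filterlim_at)
  qed
  have nat: "p u n = real (nat (\<lfloor>u * real (Suc n)\<rfloor> + 1)) / real (Suc n)" if "0 \<le> u" for u n
    using that by (simp add: p_def)
  have "f (p t n) - f (p s n) \<in> C" for n
    unfolding nat[OF st(1)] nat[OF order_trans[OF st]]
    using st by (intro grid nat_mono add_right_mono floor_mono mult_right_mono) auto
  moreover have "(\<lambda>n. f (p t n) - f (p s n)) \<longlonglongrightarrow> f t - f s"
    using st by (intro tendsto_diff p) auto
  ultimately show ?thesis
    using closed_sequentially[OF assms(2), of "\<lambda>n. f (p t n) - f (p s n)"] by simp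
qed

text \<open>The grid sum is the Stieltjes integral of a step function. These step functions converge
  pointwise to the integrand with the left limit, and f >= 0 bounds them by the indicator of (0, k],
  so dominated convergence yields both claims.\<close>

lemma
  fixes f g :: "real \<Rightarrow> real" and k :: nat
  assumes c: "c > 1" and f: "cadlag f" "\<And>t. 0 \<le> t \<Longrightarrow> 0 \<le> f t"
    and g: "cadlag g" "mono_on {0..} g"
  shows weighted_grid_sum_tendsto:
      "(\<lambda>m. \<Sum>j<k * Suc m. c powr (- f (real j / real (Suc m))) *
           (g (real (Suc j) / real (Suc m)) - g (real j / real (Suc m))))
       \<longlonglongrightarrow> stieltjes_integral (\<lambda>s. c powr (- left_limit f s)) g k"
    and set_integrable_left_limit:
      "set_integrable (interval_measure (\<lambda>s. g (max 0 s))) {0<..real k} (\<lambda>s. c powr (- left_limit f s))"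
proof -
  let ?G = "\<lambda>s. g (max 0 s)"
  let ?\<mu> = "interval_measure ?G"
  have mono: "?G x \<le> ?G y" if "x \<le> y" for x y
    using g(2) that by (auto simp: mono_on_def)
  have cont: "continuous (at_right a) ?G" for a
  proof (cases "0 \<le> a")
    case True
    have "(?G \<longlongrightarrow> g a) (at_right a)"
      using cadlag_rightD[OF g(1) True]
    proof (rule Lim_transform_eventually)
      show "\<forall>\<^sub>F x in at_right a. g x = ?G x"
        using eventually_at_right_less[of a] by eventually_elim (use True in auto)
    qed
    then show ?thesis using True by (simp add: continuous_within)
  next
    \<comment> \<open>Left of 0 the extended integrator is constant with value g 0, so
      right-continuity is trivial there.\<close>
    case False
    have "\<forall>\<^sub>F x in at_right a. g 0 = ?G x"
      using eventually_at_right[of a 0] False by (auto intro!: exI[of _ 0] simp: max_def)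
    then have "(?G \<longlongrightarrow> g 0) (at_right a)"
      by (rule Lim_transform_eventually[OF tendsto_const])
    then show ?thesis using False by (simp add: continuous_within)
  qed
  have emeas: "emeasure ?\<mu> {x<..y} = ennreal (if x \<le> y then ?G y - ?G x else 0)" for x y
    by (rule emeasure_interval_measure_Ioc_eq) (rule mono cont, assumption?)+
  \<comment> \<open>Each cell is open on the left and closed on the right, and the value is taken at
    its left end, so that the limit sees f just before x.\<close>
  define s where "s m x = (\<Sum>j<k * Suc m. indicator {real j / real (Suc m)<..real (Suc j) / real (Suc m)} x *
    c powr (- f (real j / real (Suc m))))" for m :: nat and x :: real
  define \<phi> where "\<phi> x = indicator {0<..real k} x * c powr (- left_limit f x)" for x
  have s_eq: "s m x = indicator {0<..real k} x * c powr (- f ((of_int \<lceil>x * real (Suc m)\<rceil> - 1) / real (Suc m)))" for m x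
  proof -
    let ?r = "real (Suc m)"
    have iff: "x \<in> {real j / ?r<..real (Suc j) / ?r} \<longleftrightarrow> \<lceil>x * ?r\<rceil> - 1 = int j" for j
    proof -
      have "x \<in> {real j / ?r<..real (Suc j) / ?r} \<longleftrightarrow> real j < x * ?r \<and> x * ?r \<le> real j + 1"
        by (simp add: field_simps)
      also have "\<dots> \<longleftrightarrow> \<lceil>x * ?r\<rceil> = int j + 1"
        by (simp only: ceiling_eq_iff) simp
      finally show ?thesis by auto
    qed
    \<comment> \<open>The condition that the ceiling is positive guards the truncation by
      \<open>nat\<close>, which would otherwise put every x <= 0 into cell 0.\<close>
    have "s m x = (\<Sum>j<k * Suc m. if j = nat (\<lceil>x * ?r\<rceil> - 1) \<and> 0 < \<lceil>x * ?r\<rceil> then c powr (- f (real j / ?r)) else 0)"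
      unfolding s_def
    proof (intro sum.cong refl)
      fix j
      have eq: "(j = nat (y - 1) \<and> 0 < y) \<longleftrightarrow> y - 1 = int j" for y
        by auto
      show "indicator {real j / ?r<..real (Suc j) / ?r} x * c powr (- f (real j / ?r)) =
        (if j = nat (\<lceil>x * ?r\<rceil> - 1) \<and> 0 < \<lceil>x * ?r\<rceil> then c powr (- f (real j / ?r)) else 0)"
        unfolding indicator_def iff eq by simp
    qed
    also have "\<dots> = (if 0 < \<lceil>x * ?r\<rceil> \<and> nat (\<lceil>x * ?r\<rceil> - 1) < k * Suc m
      then c powr (- f (real (nat (\<lceil>x * ?r\<rceil> - 1)) / ?r)) else 0)"
      by (cases "0 < \<lceil>x * ?r\<rceil>") (simp_all add: sum.delta del: of_nat_Suc)
    also have "0 < \<lceil>x * ?r\<rceil> \<longleftrightarrow> 0 < x"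
      by (simp add: zero_less_mult_iff)
    also have "0 < x \<and> nat (\<lceil>x * ?r\<rceil> - 1) < k * Suc m \<longleftrightarrow> x \<in> {0<..real k}"
    proof -
      have "nat (\<lceil>x * ?r\<rceil> - 1) < k * Suc m \<longleftrightarrow> x \<le> real k" if "0 < x"
      proof -
        have "0 < \<lceil>x * ?r\<rceil>" using that by simp
        then have "nat (\<lceil>x * ?r\<rceil> - 1) < k * Suc m \<longleftrightarrow> \<lceil>x * ?r\<rceil> \<le> int (k * Suc m)"
          by linarith
        also have "\<dots> \<longleftrightarrow> x * ?r \<le> real k * ?r"
          by (simp only: ceiling_le_iff of_int_of_nat_eq of_nat_mult of_int_mult)
        also have "\<dots> \<longleftrightarrow> x \<le> real k"
          by (rule mult_le_cancel_right_pos) simp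
        finally show ?thesis .
      qed
      then show ?thesis by auto
    qed
    finally show ?thesis
      by (auto simp: indicator_def of_nat_nat)
  qed
  have lim: "(\<lambda>m. s m x) \<longlonglongrightarrow> \<phi> x" for x
  proof (cases "x \<in> {0<..real k}")
    case True
    have "(\<lambda>m. f ((of_int \<lceil>x * real (Suc m)\<rceil> - 1) / real (Suc m))) \<longlonglongrightarrow> left_limit f x"
    proof (rule filterlim_compose[OF cadlag_left_limit[OF f(1)]])
      show "0 < x" using True by simp
      \<comment> \<open>The grid point lies strictly before x even if x itself is on the grid; hence
        the left limit and not the value at x.\<close>
      have "(of_int \<lceil>x * real (Suc m)\<rceil> - 1) / real (Suc m) < x" for m
        by (simp add: field_simps del: of_nat_Suc) linarith
      then have "\<forall>\<^sub>F m in sequentially. (of_int \<lceil>x * real (Suc m)\<rceil> - 1) / real (Suc m) \<in> {..<x} \<and>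
          (of_int \<lceil>x * real (Suc m)\<rceil> - 1) / real (Suc m) \<noteq> x"
        by (intro always_eventually) (auto simp: less_imp_neq)
      then show "filterlim (\<lambda>m. (of_int \<lceil>x * real (Suc m)\<rceil> - 1) / real (Suc m)) (at_left x) sequentially"
        using right_grid_tendsto(3)[of x] by (simp only: filterlim_at)
    qed
    then show ?thesis
      using True c unfolding s_eq \<phi>_def by (intro tendsto_intros) auto
  qed (simp add: s_eq \<phi>_def)
  have meas: "s m \<in> borel_measurable ?\<mu>" for m
    unfolding s_def by measurable
  then have meas\<phi>: "\<phi> \<in> borel_measurable ?\<mu>"
    by (rule borel_measurable_LIMSEQ_real[where u=s, OF lim])
  have int: "integrable ?\<mu> (indicator {0<..real k} :: real \<Rightarrow> real)"
    by (simp add: emeas)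
  have bound: "norm (s m x) \<le> indicator {0<..real k} x" for m x
  proof (cases "x \<in> {0<..real k}")
    case True
    then have "0 < \<lceil>x * real (Suc m)\<rceil>" by simp
    then have "0 \<le> f ((of_int \<lceil>x * real (Suc m)\<rceil> - 1) / real (Suc m))"
      by (intro f divide_nonneg_nonneg) auto
    then have "c powr (- f ((of_int \<lceil>x * real (Suc m)\<rceil> - 1) / real (Suc m))) \<le> c powr 0"
      using c by (intro powr_mono) auto
    then show ?thesis using True c by (simp add: s_eq)
  qed (simp add: s_eq)
  have int\<phi>: "integrable ?\<mu> \<phi>"
    by (rule integrable_dominated_convergence[where s=s, OF meas\<phi> meas int]) (intro AE_I2 lim bound)+
  then show "set_integrable ?\<mu> {0<..real k} (\<lambda>s. c powr (- left_limit f s))"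
    by (simp add: set_integrable_def \<phi>_def[abs_def])
  have "(\<lambda>m. integral\<^sup>L ?\<mu> (s m)) \<longlonglongrightarrow> integral\<^sup>L ?\<mu> \<phi>"
    by (rule integral_dominated_convergence[where s=s, OF meas\<phi> meas int]) (intro AE_I2 lim bound)+
  moreover have "integral\<^sup>L ?\<mu> (s m) = (\<Sum>j<k * Suc m. c powr (- f (real j / real (Suc m))) *
           (g (real (Suc j) / real (Suc m)) - g (real j / real (Suc m))))" for m
  proof -
    have le: "real j / real (Suc m) \<le> real (Suc j) / real (Suc m)" for j
      by (intro divide_right_mono) auto
    have nn: "0 \<le> real j / real (Suc m)" for j
      by simp
    have em_Ioc: "emeasure ?\<mu> {x<..y} = ennreal (g y - g x)" if "0 \<le> x" "x \<le> y" for x y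
      using that by (subst emeas) (simp add: max_absorb2)
    have em: "emeasure ?\<mu> {real j / real (Suc m)<..real (Suc j) / real (Suc m)} =
      ennreal (g (real (Suc j) / real (Suc m)) - g (real j / real (Suc m)))" for j
      by (rule em_Ioc[OF nn le])
    have me: "measure ?\<mu> {real j / real (Suc m)<..real (Suc j) / real (Suc m)} =
      g (real (Suc j) / real (Suc m)) - g (real j / real (Suc m))" for j
      using le[of j] g(2) unfolding measure_def em by (subst enn2real_ennreal) (auto simp: mono_on_def)
    have i0: "integrable ?\<mu> (indicator {real j / real (Suc m)<..real (Suc j) / real (Suc m)} :: real \<Rightarrow> real)" for j
      by (intro integrable_real_indicator) (simp_all add: em del: of_nat_Suc)
    have i: "integrable ?\<mu> (\<lambda>x. indicator {real j / real (Suc m)<..real (Suc j) / real (Suc m)} x *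
      c powr (- f (real j / real (Suc m))))" for j
      by (intro integrable_mult_left impI i0)
    show ?thesis
      unfolding s_def
      by (subst Bochner_Integration.integral_sum) (simp_all add: i i0 me mult.commute del: of_nat_Suc)
  qed
  moreover have "integral\<^sup>L ?\<mu> \<phi> = stieltjes_integral (\<lambda>s. c powr (- left_limit f s)) g k"
    by (simp add: stieltjes_integral_def set_lebesgue_integral_def \<phi>_def[abs_def])
  ultimately show "(\<lambda>m. \<Sum>j<k * Suc m. c powr (- f (real j / real (Suc m))) *
           (g (real (Suc j) / real (Suc m)) - g (real j / real (Suc m))))
       \<longlonglongrightarrow> stieltjes_integral (\<lambda>s. c powr (- left_limit f s)) g k"
    by simp
qed

text \<open>The integrand and the measure are nonnegative, so the integral is monotone in the
  horizon. Boundedness along the integers then gives convergence along all reals, to the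
  supremum.\<close>

lemma Lim_at_top_stieltjes_integral:
  fixes f g :: "real \<Rightarrow> real"
  assumes c: "c > 1" and f: "cadlag f" "\<And>t. 0 \<le> t \<Longrightarrow> 0 \<le> f t"
    and g: "cadlag g" "mono_on {0..} g"
    and bd: "bdd_above (range (\<lambda>k. stieltjes_integral (\<lambda>s. c powr (- left_limit f s)) g (real k)))"
  shows "(\<lambda>k. stieltjes_integral (\<lambda>s. c powr (- left_limit f s)) g (real k))
     \<longlonglongrightarrow> Lim at_top (stieltjes_integral (\<lambda>s. c powr (- left_limit f s)) g)"
proof -
  let ?I = "stieltjes_integral (\<lambda>s. c powr (- left_limit f s)) g"
  have mono: "?I s \<le> ?I t" if "s \<le> t" for s t
  proof -
    obtain k :: nat where "t \<le> real k" using real_arch_simple by blast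
    then have i: "set_integrable (interval_measure (\<lambda>s. g (max 0 s))) {0<..t} (\<lambda>s. c powr (- left_limit f s))"
      by (intro set_integrable_subset[OF set_integrable_left_limit[OF c f g, of k]]) auto
    have "{0<..s} \<subseteq> {0<..t}"
      using that by auto
    then show ?thesis
      using set_integrable_subset[OF i, of "{0<..s}"] i that
      unfolding stieltjes_integral_def set_lebesgue_integral_def set_integrable_def
      by (intro integral_mono) (auto split: split_indicator)
  qed
  define l where "l = (SUP k :: nat. ?I (real k))"
  have lim: "(\<lambda>k. ?I (real k)) \<longlonglongrightarrow> l"
    unfolding l_def by (intro LIMSEQ_incseq_SUP bd) (auto simp: incseq_def intro: mono)
  have le: "?I t \<le> l" for t
  proof -
    obtain k :: nat where "t \<le> real k" using real_arch_simple by blast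
    then have "?I t \<le> ?I (real k)" by (rule mono)
    also have "\<dots> \<le> l" unfolding l_def using bd by (intro cSUP_upper) auto
    finally show ?thesis .
  qed
  have "(?I \<longlongrightarrow> l) at_top"
  proof (rule order_tendstoI)
    fix a assume "a < l"
    then obtain k :: nat where "a < ?I (real k)"
      using order_tendstoD(1)[OF lim] by (auto simp: eventually_sequentially)
    then show "\<forall>\<^sub>F t in at_top. a < ?I t"
      using mono by (intro eventually_at_top_linorderI[of "real k"]) (auto intro: less_le_trans)
  next
    fix a assume "l < a"
    then show "\<forall>\<^sub>F t in at_top. ?I t < a"
      using le by (auto intro!: always_eventually intro: le_less_trans)
  qed
  then have "Lim at_top ?I = l"
    by (intro tendsto_Lim) auto
  with lim show ?thesis by simp
qed

section \<open>The first jump time of a counting path\<close>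

text \<open>Let T be the infimum of the times at which f is nonzero. Before T the path is 0, so all
  left limits up to and including T are 0, while f T >= 1. Hence T is the least jump time, and it is
  attained.\<close>

lemma
  fixes f :: "real \<Rightarrow> real"
  assumes f: "cadlag f" "mono_on {0..} f" "\<And>t. 0 \<le> t \<Longrightarrow> f t \<in> \<int>" "f 0 = 0" and t0: "0 \<le> t0" "f t0 \<noteq> 0"
  shows first_jump_time_pos: "0 < first_jump_time f"
    and eq_0_iff_less_first_jump_time: "0 \<le> t \<Longrightarrow> f t = 0 \<longleftrightarrow> t < first_jump_time f"
proof -
  have mono: "f s \<le> f t" if "0 \<le> s" "s \<le> t" for s t
    using f(2) that by (auto simp: mono_on_def)
  have ge1: "1 \<le> f t" if t: "0 \<le> t" "f t \<noteq> 0" for t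
  proof -
    obtain i :: int where "f t = of_int i" using f(3)[OF t(1)] by (metis Ints_cases)
    then show ?thesis using mono[of 0 t] t f(4) by auto
  qed
  define S where "S = {t. 0 \<le> t \<and> f t \<noteq> 0}"
  define T where "T = Inf S"
  have S: "S \<noteq> {}" "bdd_below S" using t0 by (auto simp: S_def intro!: bdd_belowI[of _ 0])
  have up: "f t \<noteq> 0" if "T < t" for t
  proof -
    obtain s where "s \<in> S" "s < t" using cInf_lessD[OF S(1), of t] \<open>T < t\<close> unfolding T_def by blast
    then show ?thesis using ge1[of s] mono[of s t] by (auto simp: S_def)
  qed
  have T0: "0 \<le> T" unfolding T_def using S(1) by (intro cInf_greatest) (auto simp: S_def)
  have dn: "f t = 0" if "0 \<le> t" "t < T" for t
    using cInf_lower[OF _ S(2), of t] that by (force simp: T_def S_def)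
  \<comment> \<open>Integer values leave a gap: beyond T the path is at least 1, and
    right-continuity carries this bound to T.\<close>
  have "1 \<le> f T"
  proof (rule tendsto_lowerbound[OF cadlag_rightD[OF f(1) T0]])
    show "\<forall>\<^sub>F t in at_right T. 1 \<le> f t"
      using eventually_at_right_less[of T] by eventually_elim (use up ge1 T0 in auto)
  qed simp
  then have fT: "f T \<noteq> 0" by simp
  with f(4) T0 have Tpos: "0 < T" by (cases "T = 0") auto
  have left0: "left_limit f t = 0" if "0 < t" "t \<le> T" for t
    unfolding left_limit_def
  proof (rule tendsto_Lim)
    show "(f \<longlongrightarrow> 0) (at_left t)"
    proof (rule Lim_transform_eventually[OF tendsto_const])
      show "\<forall>\<^sub>F x in at_left t. 0 = f x"
        using eventually_at_left_real[OF that(1)] by eventually_elim (use dn that in auto)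
    qed
  qed simp
  have T: "first_jump_time f = T"
    unfolding first_jump_time_def
  proof (rule cInf_eq_minimum)
    show "T \<in> {t. 0 < t \<and> f t \<noteq> left_limit f t}"
      using Tpos fT left0[of T] by simp
    show "T \<le> t" if "t \<in> {t. 0 < t \<and> f t \<noteq> left_limit f t}" for t
      using that left0[of t] dn[of t] by (cases "t < T") auto
  qed
  show "0 < first_jump_time f"
    using Tpos by (simp add: T)
  show "f t = 0 \<longleftrightarrow> t < first_jump_time f" if "0 \<le> t"
    using dn[OF that] up[of t] fT unfolding T by (metis linorder_neqE_linordered_idom)
qed

text \<open>The first grid cell on which f changes is the one containing T, so its right end is T
  rounded up to the grid. These points tend to T without ever lying before it, and right-continuity
  of g suffices.\<close>

lemma grid_first_jump_tendsto:
  fixes f g :: "real \<Rightarrow> real"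
  assumes f: "cadlag f" "mono_on {0..} f" "\<And>t. 0 \<le> t \<Longrightarrow> f t \<in> \<int>" "f 0 = 0" and t0: "0 \<le> t0" "f t0 \<noteq> 0"
    and g: "cadlag g"
  shows "(\<lambda>m. g (real (Suc (LEAST j. f (real (Suc j) / real (Suc m)) - f (real j / real (Suc m)) \<noteq> 0)) / real (Suc m)))
    \<longlonglongrightarrow> g (first_jump_time f)"
proof -
  let ?T = "first_jump_time f"
  note T = first_jump_time_pos[OF assms(1-6)] eq_0_iff_less_first_jump_time[OF assms(1-6)]
  have least: "real (Suc (LEAST j. f (real (Suc j) / real (Suc m)) - f (real j / real (Suc m)) \<noteq> 0)) = of_int \<lceil>?T * real (Suc m)\<rceil>" for m
  proof -
    let ?r = "real (Suc m)"
    define K where "K = nat (\<lceil>?T * ?r\<rceil> - 1)"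
    have pos: "0 < \<lceil>?T * ?r\<rceil>" using T(1) by simp
    then have K: "real (Suc K) = of_int \<lceil>?T * ?r\<rceil>" by (simp add: K_def)
    have "?T * ?r \<le> real (Suc K)" "real K < ?T * ?r"
      using K by linarith+
    then have "?T \<le> real (Suc K) / ?r" "real K / ?r < ?T"
      by (simp_all add: field_simps)
    then have "f (real (Suc K) / ?r) \<noteq> 0" "f (real K / ?r) = 0"
      using T(2)[of "real (Suc K) / ?r"] T(2)[of "real K / ?r"] by auto
    moreover have "K \<le> j" if "f (real (Suc j) / ?r) - f (real j / ?r) \<noteq> 0" for j
    proof (rule ccontr)
      assume "\<not> K \<le> j"
      then have "real (Suc j) \<le> real K" by linarith
      then have "real (Suc j) / ?r \<le> real K / ?r" "real j / ?r \<le> real K / ?r"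
        by (intro divide_right_mono; simp)+
      with \<open>real K / ?r < ?T\<close> have "f (real (Suc j) / ?r) = 0" "f (real j / ?r) = 0"
        using T(2)[of "real (Suc j) / ?r"] T(2)[of "real j / ?r"] by auto
      with that show False by simp
    qed
    ultimately have "(LEAST j. f (real (Suc j) / ?r) - f (real j / ?r) \<noteq> 0) = K"
      by (intro Least_equality) auto
    with K show ?thesis by simp
  qed
  \<comment> \<open>T may itself be a grid point, so the limit is taken within the closed half-line
    and not only at points beyond T.\<close>
  have cont: "(g \<longlongrightarrow> g ?T) (at ?T within {?T..})"
  proof -
    have "{?T..} - {?T} = {?T<..}" by auto
    then have "at ?T within {?T..} = at_right ?T"
      by (metis Diff_idemp at_within_def)
    then show ?thesis using cadlag_rightD[OF g] T(1) by simp
  qed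
  have ge: "?T \<le> of_int \<lceil>?T * real (Suc m)\<rceil> / real (Suc m)" for m
    by (simp add: field_simps del: of_nat_Suc)
  show ?thesis
    unfolding least using cont[folded continuous_within] right_grid_tendsto(2)[of ?T] ge
    by (auto simp: continuous_within_sequentially o_def)
qed

section \<open>Discretisation of the process\<close>

lemma (in prob_space) indep_vars_UNIV_if_lessThan:
  assumes "\<And>n. indep_vars M' X {..<n :: nat}"
  shows "indep_vars M' X UNIV"
proof -
  have "indep_sets F UNIV" if F: "\<And>n. indep_sets F {..<n :: nat}" for F
    unfolding indep_sets_finite_index_sets[of F UNIV]
  proof (intro allI impI)
    fix J :: "nat set" assume "finite J"
    then obtain n where "J \<subseteq> {..<n}" by (auto simp: finite_nat_iff_bounded)
    then show "indep_sets F J" using F by (rule indep_sets_mono_index)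
  qed
  moreover have "random_variable (M' i) (X i)" for i
    using assms[of "Suc i"] by (auto simp: indep_vars_def)
  ultimately show ?thesis
    using assms by (auto simp: indep_vars_def)
qed

lemma (in prob_space) char_distr_tendsto:
  assumes [measurable]: "\<And>n. F n \<in> borel_measurable M" "G \<in> borel_measurable M"
    and "AE \<omega> in M. (\<lambda>n. F n \<omega>) \<longlonglongrightarrow> G \<omega>"
  shows "(\<lambda>n. char (distr M borel (F n)) z) \<longlonglongrightarrow> char (distr M borel G) z"
proof -
  have "(\<lambda>n. expectation (\<lambda>\<omega>. iexp (z * F n \<omega>))) \<longlonglongrightarrow> expectation (\<lambda>\<omega>. iexp (z * G \<omega>))"
  proof (rule integral_dominated_convergence[where w="\<lambda>_. 1"])
    show "AE \<omega> in M. (\<lambda>n. iexp (z * F n \<omega>)) \<longlonglongrightarrow> iexp (z * G \<omega>)"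
      using assms(3) by eventually_elim (intro tendsto_intros)
  qed auto
  then show ?thesis by (simp add: char_def integral_distr)
qed

text \<open>\<open>rate\<close> is the jump intensity of N and \<open>mean\<close> the expectation
  of L at time 1. The pair enters through its increments and paths, the jump measure only through
  the Poisson law of N and the sign and mean of L.\<close>

locale poisson_driven_pair = prob_space M for M :: "'a measure" +
  fixes N L :: "real \<Rightarrow> 'a \<Rightarrow> real" and c rate mean :: real
  assumes c_gt_1: "c > 1" and rate_pos: "rate > 0"
    and measurable_N_L: "0 \<le> t \<Longrightarrow> N t \<in> borel_measurable M" "0 \<le> t \<Longrightarrow> L t \<in> borel_measurable M"
    and start: "AE \<omega> in M. N 0 \<omega> = 0 \<and> L 0 \<omega> = 0"
    and indep: "independent_increments M (\<lambda>t \<omega>. (N t \<omega>, L t \<omega>))"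
    and stationary: "stationary_increments M (\<lambda>t \<omega>. (N t \<omega>, L t \<omega>))"
    and cadlag_paths: "AE \<omega> in M. cadlag (\<lambda>t. (N t \<omega>, L t \<omega>))"
    and law_N: "0 < t \<Longrightarrow> distr M borel (N t) = distr (measure_pmf (poisson_pmf (rate * t))) borel real"
    and L_nonneg: "0 \<le> t \<Longrightarrow> AE \<omega> in M. 0 \<le> L t \<omega>"
    and integrable_L: "0 \<le> t \<Longrightarrow> integrable M (L t)"
    and expectation_L: "0 \<le> t \<Longrightarrow> expectation (L t) = mean * t"
begin

lemma
  fixes f :: "real \<Rightarrow> 'b :: {banach, second_countable_topology}"
  assumes "0 < t" and f [measurable]: "f \<in> borel_measurable borel"
  shows integrable_N_iff: "integrable M (\<lambda>\<omega>. f (N t \<omega>)) \<longleftrightarrow> integrable (poisson_pmf (rate * t)) (\<lambda>n. f (real n))"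
    and expectation_N: "expectation (\<lambda>\<omega>. f (N t \<omega>)) = measure_pmf.expectation (poisson_pmf (rate * t)) (\<lambda>n. f (real n))"
proof -
  note m = measurable_N_L(1)[OF less_imp_le[OF assms(1)]]
  show "integrable M (\<lambda>\<omega>. f (N t \<omega>)) \<longleftrightarrow> integrable (poisson_pmf (rate * t)) (\<lambda>n. f (real n))"
    using integrable_distr_eq[OF m f] integrable_distr_eq[of real "measure_pmf (poisson_pmf (rate * t))" borel f]
    by (simp add: law_N[OF assms(1)])
  show "expectation (\<lambda>\<omega>. f (N t \<omega>)) = measure_pmf.expectation (poisson_pmf (rate * t)) (\<lambda>n. f (real n))"
    using integral_distr[OF m f] integral_distr[of real "measure_pmf (poisson_pmf (rate * t))" borel f]
    by (simp add: law_N[OF assms(1)])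
qed

lemma prob_N:
  assumes "0 < t" and A: "A \<in> sets borel"
  shows "prob {\<omega> \<in> space M. N t \<omega> \<in> A} = measure_pmf.prob (poisson_pmf (rate * t)) {n. real n \<in> A}"
proof -
  have "prob {\<omega> \<in> space M. N t \<omega> \<in> A} = measure (distr M borel (N t)) A"
    using measurable_N_L(1)[of t] assms by (subst measure_distr) (auto simp: vimage_def Int_def conj_commute)
  also have "\<dots> = measure_pmf.prob (poisson_pmf (rate * t)) {n. real n \<in> A}"
    unfolding law_N[OF assms(1)] using A by (subst measure_distr) (auto simp: vimage_def)
  finally show ?thesis .
qed

lemma AE_N_Ints: "0 \<le> t \<Longrightarrow> AE \<omega> in M. N t \<omega> \<in> \<int> \<inter> {0..}"
proof (cases "t = 0")
  case True
  then show ?thesis using start by (auto elim!: eventually_mono)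
next
  case False
  assume "0 \<le> t"
  with False have t: "0 < t" by simp
  have C: "\<int> \<inter> {0..} \<in> sets (borel :: real measure)"
    by (intro borel_closed closed_Int closed_Ints closed_atLeast)
  have "AE x in distr (measure_pmf (poisson_pmf (rate * t))) borel real. x \<in> \<int> \<inter> {0..}"
    using C by (subst AE_distr_iff) auto
  then show ?thesis
    unfolding law_N[OF t, symmetric] using measurable_N_L(1)[OF \<open>0 \<le> t\<close>] C
    by (subst (asm) AE_distr_iff) auto
qed

lemma distr_increment:
  assumes "0 \<le> s" "0 \<le> t"
  shows "distr M borel (\<lambda>\<omega>. (N (s + t) \<omega> - N s \<omega>, L (s + t) \<omega> - L s \<omega>)) =
    distr M borel (\<lambda>\<omega>. (N t \<omega> - N 0 \<omega>, L t \<omega> - L 0 \<omega>))"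
  using stationary assms unfolding stationary_increments_def diff_Pair by blast

lemma measurable_increment:
  assumes "0 \<le> s" "0 \<le> t"
  shows "(\<lambda>\<omega>. (N t \<omega> - N s \<omega>, L t \<omega> - L s \<omega>)) \<in> borel_measurable M"
  by (intro borel_measurable_Pair borel_measurable_diff measurable_N_L assms)

text \<open>By stationarity the increment has the law of the pair at time t - s, and almost sure
  membership in a Borel set depends only on the law.\<close>

lemma AE_increment:
  assumes "0 \<le> s" "s \<le> t"
  shows "AE \<omega> in M. N t \<omega> - N s \<omega> \<in> \<int> \<inter> {0..} \<and> L t \<omega> - L s \<omega> \<in> {0..}"
proof -
  have t: "0 \<le> t - s" using assms by simp
  have C: "{x :: real \<times> real. x \<in> (\<int> \<inter> {0..}) \<times> {0..}} \<in> sets borel"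
    unfolding Collect_mem_eq
    by (intro borel_closed closed_Times closed_Int closed_Ints closed_atLeast)
  have "AE \<omega> in M. (N (t - s) \<omega> - N 0 \<omega>, L (t - s) \<omega> - L 0 \<omega>) \<in> (\<int> \<inter> {0..}) \<times> {0..}"
    using start AE_N_Ints[OF t] L_nonneg[OF t] by eventually_elim auto
  then have *: "AE x in distr M borel (\<lambda>\<omega>. (N (t - s) \<omega> - N 0 \<omega>, L (t - s) \<omega> - L 0 \<omega>)). x \<in> (\<int> \<inter> {0..}) \<times> {0..}"
    using measurable_increment[OF order_refl t] C by (subst AE_distr_iff) auto
  have "AE x in distr M borel (\<lambda>\<omega>. (N t \<omega> - N s \<omega>, L t \<omega> - L s \<omega>)). x \<in> (\<int> \<inter> {0..}) \<times> {0..}"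
  proof -
    have "distr M borel (\<lambda>\<omega>. (N t \<omega> - N s \<omega>, L t \<omega> - L s \<omega>)) =
      distr M borel (\<lambda>\<omega>. (N (t - s) \<omega> - N 0 \<omega>, L (t - s) \<omega> - L 0 \<omega>))"
      using distr_increment[OF assms(1) t] by simp
    then show ?thesis
      using * by (simp only:)
  qed
  then have "AE \<omega> in M. (N t \<omega> - N s \<omega>, L t \<omega> - L s \<omega>) \<in> (\<int> \<inter> {0..}) \<times> {0..}"
    using measurable_increment[of s t] assms C by (subst (asm) AE_distr_iff) auto
  then show ?thesis by auto
qed

text \<open>N vanishes at time n with probability exp(-rate n), which tends to 0. So the first jump
  time is almost surely finite.\<close>

lemma AE_N_nonzero: "AE \<omega> in M. \<exists>n. N (real (Suc n)) \<omega> \<noteq> 0"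
proof -
  have [measurable]: "N (real (Suc n)) \<in> borel_measurable M" for n
    by (rule measurable_N_L) simp
  define A where "A = {\<omega> \<in> space M. \<forall>n. N (real (Suc n)) \<omega> = 0}"
  have A [measurable]: "A \<in> sets M"
    unfolding A_def by measurable
  have le: "prob A \<le> exp (- rate) ^ Suc n" for n
  proof -
    have "prob A \<le> prob {\<omega> \<in> space M. N (real (Suc n)) \<omega> \<in> {0}}"
      by (intro finite_measure_mono) (auto simp: A_def simp del: of_nat_Suc)
    also have "\<dots> = measure_pmf.prob (poisson_pmf (rate * real (Suc n))) {0}"
      by (subst prob_N) (auto intro!: arg_cong[where f="measure_pmf.prob _"])
    also have "\<dots> = exp (- rate) ^ Suc n"
      using rate_pos by (subst measure_pmf_single) (simp add: exp_of_nat_mult[symmetric] mult.commute del: power_Suc of_nat_Suc)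
    finally show ?thesis .
  qed
  have "(\<lambda>n. exp (- rate) ^ Suc n) \<longlonglongrightarrow> 0"
    using rate_pos by (intro LIMSEQ_Suc[OF LIMSEQ_power_zero]) auto
  then have "prob A \<le> 0"
    by (rule LIMSEQ_le_const) (use le in auto)
  then have "prob A = 0"
    by (simp add: measure_le_0_iff)
  then have "AE \<omega> in M. \<omega> \<notin> A"
    by (simp add: prob_eq_0)
  then show ?thesis
    by (auto simp: A_def elim!: eventually_mono[OF eventually_conj[OF _ AE_space]])
qed

text \<open>This gathers what the pathwise lemmas ask for, so that convergence of the grid sums can
  be argued for a single path.\<close>

definition regular_path :: "'a \<Rightarrow> bool" where
  "regular_path \<omega> \<longleftrightarrow> N 0 \<omega> = 0 \<and> L 0 \<omega> = 0 \<and> cadlag (\<lambda>t. N t \<omega>) \<and> cadlag (\<lambda>t. L t \<omega>) \<and>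
     mono_on {0..} (\<lambda>t. N t \<omega>) \<and> mono_on {0..} (\<lambda>t. L t \<omega>) \<and>
     (\<forall>t\<ge>0. 0 \<le> N t \<omega> \<and> N t \<omega> \<in> \<int>) \<and> (\<exists>t\<ge>0. N t \<omega> \<noteq> 0)"

text \<open>The signs and integrality of increments hold off one null set for all rational grids at
  once, since these are countably many conditions. The cadlag property extends them to all
  times.\<close>

lemma AE_regular_path: "AE \<omega> in M. regular_path \<omega>"
proof -
  have "AE \<omega> in M. \<forall>i j n. i \<le> j \<longrightarrow>
     N (real j / real (Suc n)) \<omega> - N (real i / real (Suc n)) \<omega> \<in> \<int> \<inter> {0..} \<and>
     L (real j / real (Suc n)) \<omega> - L (real i / real (Suc n)) \<omega> \<in> {0..}"
    unfolding AE_all_countable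
  proof (intro allI)
    fix i j n :: nat
    show "AE \<omega> in M. i \<le> j \<longrightarrow>
      N (real j / real (Suc n)) \<omega> - N (real i / real (Suc n)) \<omega> \<in> \<int> \<inter> {0..} \<and>
      L (real j / real (Suc n)) \<omega> - L (real i / real (Suc n)) \<omega> \<in> {0..}"
    proof (cases "i \<le> j")
      case True
      then show ?thesis
        using AE_increment[of "real i / real (Suc n)" "real j / real (Suc n)"]
        by (simp add: divide_right_mono del: of_nat_Suc Int_iff atLeast_iff)
    qed simp
  qed
  with start cadlag_paths AE_N_nonzero show ?thesis
  proof eventually_elim
    case (elim \<omega>)
    have cad: "cadlag (\<lambda>t. N t \<omega>)" "cadlag (\<lambda>t. L t \<omega>)"
      using cadlag_fst[OF elim(2)] cadlag_snd[OF elim(2)] by simp_all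
    have N: "N t \<omega> - N s \<omega> \<in> \<int> \<inter> {0..}" if "0 \<le> s" "s \<le> t" for s t
      by (rule cadlag_increment_mem_closed[OF cad(1) _ conjunct1[OF elim(4)[rule_format]] that])
         (intro closed_Int closed_Ints closed_atLeast)
    have L: "L t \<omega> - L s \<omega> \<in> {0..}" if "0 \<le> s" "s \<le> t" for s t
      by (rule cadlag_increment_mem_closed[OF cad(2) closed_atLeast conjunct2[OF elim(4)[rule_format]] that])
    have "0 \<le> N t \<omega> \<and> N t \<omega> \<in> \<int>" if "0 \<le> t" for t
      using N[OF order_refl that] elim(1) by simp
    moreover have "mono_on {0..} (\<lambda>t. N t \<omega>)"
    proof (rule mono_onI)
      fix s t :: real assume "s \<in> {0..}" "s \<le> t"
      then show "N s \<omega> \<le> N t \<omega>" using N[of s t] by simp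
    qed
    moreover have "mono_on {0..} (\<lambda>t. L t \<omega>)"
    proof (rule mono_onI)
      fix s t :: real assume "s \<in> {0..}" "s \<le> t"
      then show "L s \<omega> \<le> L t \<omega>" using L[of s t] by simp
    qed
    moreover have "\<exists>t\<ge>0. N t \<omega> \<noteq> 0"
      using elim(3) by (metis of_nat_0_le_iff)
    ultimately show ?case
      using cad elim(1) by (simp add: regular_path_def)
  qed
qed

text \<open>The mesh is 1 / (m + 1), so that every natural number m is admissible.\<close>

definition stepN :: "nat \<Rightarrow> nat \<Rightarrow> 'a \<Rightarrow> real" where
  "stepN m j \<omega> = N (real (Suc j) / real (Suc m)) \<omega> - N (real j / real (Suc m)) \<omega>"

definition stepL :: "nat \<Rightarrow> nat \<Rightarrow> 'a \<Rightarrow> real" where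
  "stepL m j \<omega> = L (real (Suc j) / real (Suc m)) \<omega> - L (real j / real (Suc m)) \<omega>"

lemma iid_steps_grid: "iid_steps M (stepN m) (stepL m) c"
proof unfold_locales
  show "c > 1" by (rule c_gt_1)
  show "indep_vars (\<lambda>_. borel) (\<lambda>j \<omega>. (stepN m j \<omega>, stepL m j \<omega>)) UNIV"
  proof (rule indep_vars_UNIV_if_lessThan)
    fix n
    have "0 \<le> real 0 / real (Suc m) \<and> (\<forall>i<n. real i / real (Suc m) < real (Suc i) / real (Suc m))"
      by (auto intro!: divide_strict_right_mono)
    then show "indep_vars (\<lambda>_. borel) (\<lambda>j \<omega>. (stepN m j \<omega>, stepL m j \<omega>)) {..<n}"
      using indep unfolding independent_increments_def stepN_def stepL_def diff_Pair
      by (elim allE[of _ n] allE[of _ "\<lambda>i. real i / real (Suc m)"]) blast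
  qed
  have "distr M borel (\<lambda>\<omega>. (stepN m i \<omega>, stepL m i \<omega>)) =
    distr M borel (\<lambda>\<omega>. (N (1 / real (Suc m)) \<omega> - N 0 \<omega>, L (1 / real (Suc m)) \<omega> - L 0 \<omega>))" for i
    using distr_increment[of "real i / real (Suc m)" "1 / real (Suc m)"]
    by (simp add: stepN_def stepL_def add_divide_distrib add.commute)
  then show "distr M borel (\<lambda>\<omega>. (stepN m j \<omega>, stepL m j \<omega>)) = distr M borel (\<lambda>\<omega>. (stepN m 0 \<omega>, stepL m 0 \<omega>))" for j
    by simp
qed

sublocale grid: iid_steps M "stepN m" "stepL m" c for m
  by (rule iid_steps_grid)

lemma
  shows AE_stepN_0: "AE \<omega> in M. stepN m 0 \<omega> = N (1 / real (Suc m)) \<omega>"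
    and AE_stepL_0: "AE \<omega> in M. stepL m 0 \<omega> = L (1 / real (Suc m)) \<omega>"
  using start by (auto simp: stepN_def stepL_def elim!: eventually_mono)

text \<open>As the process starts at 0 only almost surely, the first step is replaced by the value
  at time h up to a null set. The exponent in \<open>expectation_decay\<close> comes from the
  Poisson generating function at 1 / c.\<close>

lemma
  fixes m :: nat
  defines "h \<equiv> 1 / real (Suc m)"
  shows integrable_decay: "integrable M (\<lambda>\<omega>. c powr (- stepN m 0 \<omega>))"
    and expectation_decay: "expectation (\<lambda>\<omega>. c powr (- stepN m 0 \<omega>)) = exp (- (rate * (1 - 1 / c)) * h)"
    and integrable_stepL: "integrable M (stepL m 0)"
    and expectation_stepL: "expectation (stepL m 0) = mean * h"
    and expectation_abs_stepL: "expectation (\<lambda>\<omega>. \<bar>stepL m 0 \<omega>\<bar>) = mean * h"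
    and prob_stepN_nonzero: "prob {\<omega> \<in> space M. stepN m 0 \<omega> \<noteq> 0} = 1 - exp (- rate * h)"
    and prob_stepN_ge_2: "prob {\<omega> \<in> space M. stepN m 0 \<omega> \<notin> {0, 1}} = 1 - exp (- rate * h) - rate * h * exp (- rate * h)"
proof -
  have h: "0 < h" "0 \<le> h" and lh: "0 < rate * h" using rate_pos by (simp_all add: h_def)
  have [measurable]: "N h \<in> borel_measurable M" "L h \<in> borel_measurable M"
    using measurable_N_L h by auto
  note N0 = AE_stepN_0[of m, folded h_def] and L0 = AE_stepL_0[of m, folded h_def]
  have m: "(\<lambda>x. c powr (- x)) \<in> borel_measurable borel"
    by measurable
  have pow: "c powr (- real n) = (1 / c) ^ n" for n
    using c_gt_1 by (simp add: powr_minus powr_realpow power_one_over inverse_eq_divide)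
  have i: "integrable M (\<lambda>\<omega>. c powr (- N h \<omega>))"
    unfolding integrable_N_iff[OF h(1) m] pow
    using c_gt_1 by (intro integrable_poisson_pmf_power lh) auto
  then show "integrable M (\<lambda>\<omega>. c powr (- stepN m 0 \<omega>))"
    by (rule integrable_cong_AE_imp) (use N0 in \<open>auto elim: eventually_mono\<close>)
  have "expectation (\<lambda>\<omega>. c powr (- stepN m 0 \<omega>)) = expectation (\<lambda>\<omega>. c powr (- N h \<omega>))"
    using N0 by (intro integral_cong_AE) (auto elim: eventually_mono)
  also have "\<dots> = exp (- (rate * (1 - 1 / c)) * h)"
    unfolding expectation_N[OF h(1) m] pow
    using c_gt_1 by (subst expectation_poisson_pmf_power[OF lh]) (auto simp: field_simps)
  finally show "expectation (\<lambda>\<omega>. c powr (- stepN m 0 \<omega>)) = exp (- (rate * (1 - 1 / c)) * h)" .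
  show "integrable M (stepL m 0)"
    by (rule integrable_cong_AE_imp[OF integrable_L[OF h(2)]]) (use L0 in \<open>auto elim: eventually_mono\<close>)
  have "expectation (stepL m 0) = expectation (L h)"
    using L0 by (intro integral_cong_AE) auto
  then show "expectation (stepL m 0) = mean * h"
    using expectation_L[OF h(2)] by simp
  have "expectation (\<lambda>\<omega>. \<bar>stepL m 0 \<omega>\<bar>) = expectation (L h)"
    using L0 L_nonneg[OF h(2)] by (intro integral_cong_AE) (auto elim: eventually_elim2)
  then show "expectation (\<lambda>\<omega>. \<bar>stepL m 0 \<omega>\<bar>) = mean * h"
    using expectation_L[OF h(2)] by simp
  have prob: "prob {\<omega> \<in> space M. stepN m 0 \<omega> \<in> A} = measure_pmf.prob (poisson_pmf (rate * h)) {n. real n \<in> A}"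
    if [measurable]: "A \<in> sets borel" for A
    unfolding prob_N[OF h(1) that, symmetric]
    by (rule finite_measure_eq_AE) (use N0 in \<open>auto elim: eventually_mono\<close>)
  have eq: "{n. real n \<in> - {0}} = UNIV - {0}" "{n. real n \<in> - {0, 1}} = UNIV - {0, 1}"
    by auto
  have compl: "measure_pmf.prob (poisson_pmf (rate * h)) (UNIV - A) = 1 - (\<Sum>n\<in>A. pmf (poisson_pmf (rate * h)) n)" if "finite A" for A
    using measure_pmf.prob_compl[of A "poisson_pmf (rate * h)"] that by (simp add: measure_measure_pmf_finite)
  show "prob {\<omega> \<in> space M. stepN m 0 \<omega> \<noteq> 0} = 1 - exp (- rate * h)"
    using prob[of "- {0}"] compl[of "{0}"] lh unfolding eq by simp
  show "prob {\<omega> \<in> space M. stepN m 0 \<omega> \<notin> {0, 1}} = 1 - exp (- rate * h) - rate * h * exp (- rate * h)"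
    using prob[of "- {0, 1}"] compl[of "{0, 1}"] lh unfolding eq by simp
qed

end

section \<open>The infinite product and elementary exponential estimates\<close>

text \<open>Iterating the functional equation leaves the remainder char(b^n z), which tends to
  char(0) = 1 by continuity. Since \<open>has_prod\<close> demands a nonzero limit after finitely
  many factors, zeros of the characteristic function need separate care.\<close>

lemma char_has_prod:
  fixes f :: "real \<Rightarrow> complex" and b :: real
  assumes "real_distribution \<mu>" and b: "0 < b" "b < 1" and f: "\<And>z. char \<mu> z = f z * char \<mu> (b * z)"
  shows "(\<lambda>n. f (b ^ n * z)) has_prod char \<mu> z"
proof -
  interpret real_distribution \<mu> by fact
  have lim: "(\<lambda>n. char \<mu> (b ^ n * y)) \<longlonglongrightarrow> 1" for y
  proof -
    have "(\<lambda>n. b ^ n * y) \<longlonglongrightarrow> 0"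
      using b by (intro tendsto_mult_left_zero LIMSEQ_power_zero) auto
    then have "(\<lambda>n. char \<mu> (b ^ n * y)) \<longlonglongrightarrow> char \<mu> 0"
      by (rule isCont_tendsto_compose[OF isCont_char])
    then show ?thesis by (simp add: char_zero)
  qed
  have fin: "char \<mu> y = (\<Prod>i<n. f (b ^ i * y)) * char \<mu> (b ^ n * y)" for n y
  proof (induction n)
    case (Suc n)
    then show ?case using f[of "b ^ n * y"] by (simp add: mult.assoc)
  qed simp
  \<comment> \<open>The partial products are recovered by dividing by the remainder, which is
    eventually nonzero; this also covers arguments at which the limit is 0.\<close>
  have prod: "(\<lambda>n. \<Prod>i\<le>n. f (b ^ i * y)) \<longlonglongrightarrow> char \<mu> y" for y
  proof (rule Lim_transform_eventually)
    show "(\<lambda>n. char \<mu> y / char \<mu> (b ^ Suc n * y)) \<longlonglongrightarrow> char \<mu> y"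
      using tendsto_divide[OF tendsto_const LIMSEQ_Suc[OF lim[of y]], of "char \<mu> y"] by simp
    have "\<forall>\<^sub>F n in sequentially. char \<mu> (b ^ Suc n * y) \<noteq> 0"
      using tendsto_imp_eventually_ne[OF LIMSEQ_Suc[OF lim[of y]]] by simp
    then show "\<forall>\<^sub>F n in sequentially. char \<mu> y / char \<mu> (b ^ Suc n * y) = (\<Prod>i\<le>n. f (b ^ i * y))"
    proof eventually_elim
      case (elim n)
      then show ?case
        using fin[of y "Suc n"] unfolding lessThan_Suc_atMost by (simp add: divide_eq_eq)
    qed
  qed
  have raw: "raw_has_prod (\<lambda>n. f (b ^ n * z)) M (char \<mu> (b ^ M * z))" if "char \<mu> (b ^ M * z) \<noteq> 0" for M
    using prod[of "b ^ M * z"] that by (simp add: raw_has_prod_def power_add mult.assoc)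
  show ?thesis
  proof (cases "char \<mu> z = 0")
    case False
    then show ?thesis using raw[of 0] by (simp add: has_prod_def)
  next
    case True
    \<comment> \<open>Take the first scale at which the characteristic function is nonzero. The
      factor just before it must vanish, and the product from there on has a nonzero limit.\<close>
    define m where "m = (LEAST m. char \<mu> (b ^ m * z) \<noteq> 0)"
    have "\<exists>m. char \<mu> (b ^ m * z) \<noteq> 0"
      using tendsto_imp_eventually_ne[OF lim[of z], of 0] by (auto simp: eventually_sequentially)
    then have m: "char \<mu> (b ^ m * z) \<noteq> 0"
      unfolding m_def by (rule LeastI_ex)
    with True obtain i where i: "m = Suc i" by (cases m) auto
    then have "char \<mu> (b ^ i * z) = 0"
      using not_less_Least[of i "\<lambda>m. char \<mu> (b ^ m * z) \<noteq> 0"] by (simp add: m_def)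
    then have "f (b ^ i * z) = 0"
      using f[of "b ^ i * z"] m by (simp add: i mult.assoc)
    then show ?thesis
      using raw[OF m] True unfolding i has_prod_def by blast
  qed
qed

text \<open>From exp(a h) >= 1 + a h the right side is at least a h / (1 + a h), and h <= 1 makes
  the constant uniform. The bound serves both the probability of a move in one step and the
  geometric series of the weights.\<close>

lemma one_minus_exp_ge:
  fixes a h :: real
  assumes "0 < a" "0 < h" "h \<le> 1"
  shows "a / (1 + a) * h \<le> 1 - exp (- a * h)"
proof -
  have ah: "0 < a * h" "a * h \<le> a" using assms by auto
  have "exp (- a * h) \<le> 1 / (1 + a * h)"
    using exp_ge_add_one_self[of "a * h"] ah by (simp add: exp_minus field_simps)
  then have "1 - 1 / (1 + a * h) \<le> 1 - exp (- a * h)" by simp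
  moreover have "a * h / (1 + a) \<le> a * h / (1 + a * h)"
    using ah by (intro divide_left_mono) auto
  moreover have "1 - 1 / (1 + a * h) = a * h / (1 + a * h)"
    using ah by (simp add: field_simps)
  ultimately show ?thesis by (simp add: field_simps)
qed

text \<open>The left side is the probability that a Poisson variable of rate x is at least 2. The
  bound 1 - x for exp(-x) shows that it is of second order.\<close>

lemma one_minus_exp_poly_le:
  fixes x :: real
  assumes "0 \<le> x"
  shows "1 - exp (- x) - x * exp (- x) \<le> x ^ 2"
proof -
  have "(1 + x) * (1 - x) \<le> (1 + x) * exp (- x)"
    using exp_ge_add_one_self[of "- x"] assms by (intro mult_left_mono) auto
  then show ?thesis by (simp add: algebra_simps power2_eq_square)
qed

section \<open>Passage to the limit in the mesh and in the horizon\<close>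

context poisson_driven_pair
begin

abbreviation path_integral :: "'a \<Rightarrow> real \<Rightarrow> real" where
  "path_integral \<omega> \<equiv> stieltjes_integral (\<lambda>s. c powr (- left_limit (\<lambda>t. N t \<omega>) s)) (\<lambda>t. L t \<omega>)"

text \<open>One unit of time takes m + 1 steps, so \<open>k * Suc m\<close> steps reach the horizon
  k.\<close>

abbreviation grid_integral :: "nat \<Rightarrow> nat \<Rightarrow> 'a \<Rightarrow> real" where
  "grid_integral m k \<equiv> grid.weighted_sum m 0 (k * Suc m)"

abbreviation "decay \<equiv> rate * (1 - 1 / c)"

lemma decay_pos: "0 < decay"
  using c_gt_1 rate_pos by simp

lemma mean_nonneg: "0 \<le> mean"
proof -
  have "0 \<le> expectation (L 1)"
    using L_nonneg[of 1] by (intro integral_nonneg_AE) auto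
  then show ?thesis using expectation_L[of 1] by simp
qed

lemma grid_integral_eq:
  assumes "regular_path \<omega>"
  shows "grid_integral m k \<omega> = (\<Sum>j<k * Suc m. c powr (- N (real j / real (Suc m)) \<omega>) *
    (L (real (Suc j) / real (Suc m)) \<omega> - L (real j / real (Suc m)) \<omega>))"
proof -
  have "(\<Sum>i<j. stepN m i \<omega>) = N (real j / real (Suc m)) \<omega>" for j
    using assms sum_lessThan_telescope[of "\<lambda>j. N (real j / real (Suc m)) \<omega>" j]
    by (simp add: stepN_def regular_path_def)
  then show ?thesis
    by (simp only: grid.weighted_sum_def stepL_def add_0)
qed

lemma grid_integral_tendsto:
  assumes "regular_path \<omega>"
  shows "(\<lambda>m. grid_integral m k \<omega>) \<longlonglongrightarrow> path_integral \<omega> (real k)"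
  unfolding grid_integral_eq[OF assms]
  using assms by (intro weighted_grid_sum_tendsto[OF c_gt_1]) (simp_all add: regular_path_def)

lemma stepL_nonneg:
  assumes "regular_path \<omega>"
  shows "0 \<le> L (real (Suc j) / real (Suc m)) \<omega> - L (real j / real (Suc m)) \<omega>"
proof -
  have "mono_on {0..} (\<lambda>t. L t \<omega>)"
    using assms by (simp only: regular_path_def)
  moreover have "real j / real (Suc m) \<le> real (Suc j) / real (Suc m)"
    by (intro divide_right_mono) auto
  ultimately have "L (real j / real (Suc m)) \<omega> \<le> L (real (Suc j) / real (Suc m)) \<omega>"
    by (intro mono_onD[of "{0..}" "\<lambda>t. L t \<omega>"]) auto
  then show ?thesis by simp
qed

lemma grid_integral_nonneg:
  assumes "regular_path \<omega>"
  shows "0 \<le> grid_integral m k \<omega>"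
  unfolding grid_integral_eq[OF assms]
  by (intro sum_nonneg mult_nonneg_nonneg stepL_nonneg[OF assms] powr_ge_zero)

lemma stopped_sum_tendsto:
  assumes "regular_path \<omega>"
  shows "(\<lambda>m. grid.stopped_sum m \<omega>) \<longlonglongrightarrow> L (first_jump_time (\<lambda>t. N t \<omega>)) \<omega>"
proof -
  have eq: "grid.stopped_sum m \<omega> = L (real (Suc (LEAST j. N (real (Suc j) / real (Suc m)) \<omega> -
      N (real j / real (Suc m)) \<omega> \<noteq> 0)) / real (Suc m)) \<omega>" for m
  proof -
    have "L 0 \<omega> = 0"
      using assms by (simp only: regular_path_def)
    then show ?thesis
      using sum_lessThan_telescope[of "\<lambda>j. L (real j / real (Suc m)) \<omega>" "Suc (LEAST j. stepN m j \<omega> \<noteq> 0)"]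
      unfolding grid.stopped_sum_def lessThan_Suc_atMost stepL_def[symmetric] stepN_def[symmetric] by simp
  qed
  obtain t0 where "0 \<le> t0" "N t0 \<omega> \<noteq> 0"
    using assms by (auto simp: regular_path_def)
  then show ?thesis
    unfolding eq using assms by (intro grid_first_jump_tendsto) (simp_all add: regular_path_def)
qed

text \<open>The bound is uniform in the mesh and the horizon: the geometric series contributes at
  most 1 / (1 - beta), which is of order 1 / h and is compensated by the mean increment
  \<open>mean * h\<close>.\<close>

lemma expectation_grid_integral_le: "expectation (grid_integral m k) \<le> mean * ((1 + decay) / decay)"
proof -
  define h where "h = 1 / real (Suc m)"
  have h: "0 < h" "h \<le> 1" by (simp_all add: h_def)
  define \<beta> where "\<beta> = exp (- decay * h)"
  have \<beta>: "0 < \<beta>" "\<beta> < 1"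
    using mult_pos_pos[OF decay_pos h(1)] by (simp_all add: \<beta>_def)
  have "(\<Sum>j<n. \<beta> ^ j) \<le> 1 / (1 - \<beta>)" for n
  proof -
    have "(\<Sum>j<n. \<beta> ^ j) = (1 - \<beta> ^ n) / (1 - \<beta>)"
      using \<beta> by (simp add: sum_gp_strict)
    also have "\<dots> \<le> 1 / (1 - \<beta>)"
      using \<beta> by (intro divide_right_mono) auto
    finally show ?thesis .
  qed
  then have "expectation (grid_integral m k) \<le> 1 / (1 - \<beta>) * (mean * h)"
    unfolding grid.expectation_weighted_sum[OF integrable_decay integrable_stepL] expectation_decay expectation_stepL
      h_def[symmetric] \<beta>_def[symmetric]
    using mean_nonneg h by (intro mult_right_mono) auto
  also have "\<dots> = mean * (h / (1 - \<beta>))" by simp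
  also have "\<dots> \<le> mean * ((1 + decay) / decay)"
  proof (intro mult_left_mono mean_nonneg)
    have "decay / (1 + decay) * h \<le> 1 - \<beta>"
      unfolding \<beta>_def by (rule one_minus_exp_ge[OF decay_pos h])
    then show "h / (1 - \<beta>) \<le> (1 + decay) / decay"
      using decay_pos \<beta> by (simp add: divide_simps mult.commute)
  qed
  finally show ?thesis .
qed

lemma integrable_grid_integral: "integrable M (grid_integral m k)"
  unfolding grid.weighted_sum_def
  using grid.integrable_weighted_step[OF integrable_decay integrable_stepL] by simp

text \<open>The uniform bound on the means passes to the iterated lower limit over m and k, which is
  therefore almost surely finite. On a regular path that lower limit is the supremum of the
  increasing integrals, so the improper integral exists.\<close>

lemma AE_path_integral_bounded: "AE \<omega> in M. bdd_above (range (\<lambda>k. path_integral \<omega> (real k)))"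
proof -
  let ?C = "mean * ((1 + decay) / decay)"
  let ?F = "\<lambda>m k \<omega>. ennreal (grid_integral m k \<omega>)"
  have le: "(\<integral>\<^sup>+\<omega>. ?F m k \<omega> \<partial>M) \<le> ennreal ?C" for m k
  proof -
    have "(\<integral>\<^sup>+\<omega>. ?F m k \<omega> \<partial>M) = ennreal (expectation (grid_integral m k))"
      using AE_regular_path grid_integral_nonneg
      by (intro nn_integral_eq_integral integrable_grid_integral) (auto elim: eventually_mono)
    then show ?thesis
      using expectation_grid_integral_le[of m k] by (simp add: ennreal_leI)
  qed
  \<comment> \<open>Fatou is applied twice, for the horizon outside and for the mesh inside.\<close>
  have "(\<integral>\<^sup>+\<omega>. liminf (\<lambda>k. liminf (\<lambda>m. ?F m k \<omega>)) \<partial>M) \<le> liminf (\<lambda>k. \<integral>\<^sup>+\<omega>. liminf (\<lambda>m. ?F m k \<omega>) \<partial>M)"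
    by (rule nn_integral_liminf) measurable
  also have "\<dots> \<le> liminf (\<lambda>k. liminf (\<lambda>m. \<integral>\<^sup>+\<omega>. ?F m k \<omega> \<partial>M))"
    by (intro Liminf_mono always_eventually allI nn_integral_liminf) measurable
  also have "\<dots> \<le> liminf (\<lambda>k :: nat. liminf (\<lambda>m :: nat. ennreal ?C))"
    by (intro Liminf_mono always_eventually allI le)
  also have "\<dots> = ennreal ?C"
    by (simp add: Liminf_const)
  finally have "(\<integral>\<^sup>+\<omega>. liminf (\<lambda>k. liminf (\<lambda>m. ?F m k \<omega>)) \<partial>M) \<noteq> \<infinity>"
    by (auto simp: top_unique)
  then have "AE \<omega> in M. liminf (\<lambda>k. liminf (\<lambda>m. ?F m k \<omega>)) \<noteq> \<infinity>"
    by (intro nn_integral_PInf_AE) measurable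
  with AE_regular_path show ?thesis
  proof eventually_elim
    case (elim \<omega>)
    let ?I = "\<lambda>k. path_integral \<omega> (real k)"
    have "liminf (\<lambda>m. ?F m k \<omega>) = ennreal (?I k)" for k
      by (intro lim_imp_Liminf tendsto_ennrealI grid_integral_tendsto elim) simp
    with elim(2) have fin: "liminf (\<lambda>k. ennreal (?I k)) \<noteq> \<infinity>" by simp
    have mono: "?I k \<le> ?I l" if "k \<le> l" for k l
    proof (rule LIMSEQ_le[OF grid_integral_tendsto[OF elim(1)] grid_integral_tendsto[OF elim(1)]], intro exI[of _ 0] allI impI)
      fix m
      have "{..<k * Suc m} \<subseteq> {..<l * Suc m}"
        using mult_right_mono[OF that, of "Suc m"] by auto
      then show "grid_integral m k \<omega> \<le> grid_integral m l \<omega>"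
        unfolding grid_integral_eq[OF elim(1)]
        by (intro sum_mono2 mult_nonneg_nonneg stepL_nonneg[OF elim(1)] powr_ge_zero finite_lessThan)
    qed
    have nn: "0 \<le> ?I k" for k
      by (rule LIMSEQ_le_const[OF grid_integral_tendsto[OF elim(1)]]) (intro exI[of _ 0] allI impI grid_integral_nonneg[OF elim(1)])
    have inc: "incseq (\<lambda>k. ennreal (?I k))"
      by (intro incseq_def[THEN iffD2] allI impI ennreal_leI mono)
    have "liminf (\<lambda>k. ennreal (?I k)) = (SUP k. ennreal (?I k))"
      by (rule lim_imp_Liminf[OF _ LIMSEQ_SUP[OF inc]]) simp
    with fin obtain B where B: "(SUP k. ennreal (?I k)) = ennreal B" "0 \<le> B"
      by (cases "SUP k. ennreal (?I k)") (auto simp: top_ennreal_def)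
    have "?I k \<le> B" for k
      using SUP_upper[of k UNIV "\<lambda>k. ennreal (?I k)"] B by simp
    then show ?case by (intro bdd_aboveI[of _ B]) auto
  qed
qed

text \<open>All terms of the one-step estimate are compared with h and h is cancelled. The factor
  \<open>(1 + rate) / rate\<close> inverts the lower bound for the probability of a move, and
  \<open>2 * rate ^ 2\<close> comes from two or more jumps in one step.\<close>

lemma char_grid_approx:
  "cmod (char (distr M borel (grid_integral m k)) z -
      char (distr M borel (grid.stopped_sum m)) z * char (distr M borel (grid_integral m k)) (z / c))
    \<le> (1 + rate) / rate * (2 * rate ^ 2 * (1 / real (Suc m)) + \<bar>z\<bar> * mean * exp (- decay) ^ k)" (is "?D \<le> _")
proof -
  define h where "h = 1 / real (Suc m)"
  have h: "0 < h" "h \<le> 1" by (simp_all add: h_def)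
  \<comment> \<open>Over k (m + 1) steps the decay adds up to a factor that depends on the horizon
    only, not on the mesh.\<close>
  have "real (k * Suc m) * h = real k"
    by (simp add: h_def field_simps)
  then have "real (k * Suc m) * (- decay * h) = real k * (- decay)"
    by (metis mult.assoc mult.commute)
  then have pow: "exp (- decay * h) ^ (k * Suc m) = exp (- decay) ^ k"
    by (simp only: exp_of_nat_mult[symmetric])
  have "?D * (rate / (1 + rate) * h) \<le> ?D * (1 - exp (- rate * h))"
    using one_minus_exp_ge[OF rate_pos h] by (intro mult_left_mono) auto
  also have "\<dots> \<le> 2 * (1 - exp (- rate * h) - rate * h * exp (- rate * h)) + \<bar>z\<bar> * (exp (- decay) ^ k * (mean * h))"
    using grid.char_weighted_sum_approx[OF integrable_decay[of m] integrable_stepL[of m], of "k * Suc m" z]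
    unfolding prob_stepN_nonzero prob_stepN_ge_2 expectation_decay expectation_abs_stepL h_def[symmetric] pow .
  also have "\<dots> \<le> 2 * (rate * h) ^ 2 + \<bar>z\<bar> * (exp (- decay) ^ k * (mean * h))"
    using one_minus_exp_poly_le[of "rate * h"] rate_pos h by simp
  also have "\<dots> = (2 * rate ^ 2 * h + \<bar>z\<bar> * mean * exp (- decay) ^ k) * h"
    by (simp add: algebra_simps power2_eq_square)
  finally have "?D * (rate / (1 + rate)) * h \<le> (2 * rate ^ 2 * h + \<bar>z\<bar> * mean * exp (- decay) ^ k) * h"
    by (simp only: mult.assoc)
  then have "?D * (rate / (1 + rate)) \<le> 2 * rate ^ 2 * h + \<bar>z\<bar> * mean * exp (- decay) ^ k"
    by (rule mult_right_le_imp_le) (rule h)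
  then have "?D \<le> (2 * rate ^ 2 * h + \<bar>z\<bar> * mean * exp (- decay) ^ k) / (rate / (1 + rate))"
    using rate_pos by (subst pos_le_divide_eq) auto
  then show ?thesis
    by (simp add: h_def mult.commute)
qed

text \<open>These versions are limits of measurable sequences and hence measurable on the whole
  space; almost surely they coincide with the pathwise functionals.\<close>

definition horizon_integral :: "nat \<Rightarrow> 'a \<Rightarrow> real" where
  "horizon_integral k \<omega> = lim (\<lambda>m. grid_integral m k \<omega>)"

definition total_integral :: "'a \<Rightarrow> real" where
  "total_integral \<omega> = lim (\<lambda>k. horizon_integral k \<omega>)"

definition stopped_value :: "'a \<Rightarrow> real" where
  "stopped_value \<omega> = lim (\<lambda>m. grid.stopped_sum m \<omega>)"

lemma measurable_horizon_integral [measurable]: "horizon_integral k \<in> borel_measurable M"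
  unfolding horizon_integral_def by measurable

lemma measurable_total_integral [measurable]: "total_integral \<in> borel_measurable M"
  unfolding total_integral_def by measurable

lemma measurable_stopped_value [measurable]: "stopped_value \<in> borel_measurable M"
  unfolding stopped_value_def by measurable

lemma horizon_integral_eq: "regular_path \<omega> \<Longrightarrow> horizon_integral k \<omega> = path_integral \<omega> (real k)"
  unfolding horizon_integral_def by (intro limI grid_integral_tendsto)

lemma stopped_value_eq: "regular_path \<omega> \<Longrightarrow> stopped_value \<omega> = L (first_jump_time (\<lambda>t. N t \<omega>)) \<omega>"
  unfolding stopped_value_def by (intro limI stopped_sum_tendsto)

lemma AE_horizon_integral_tendsto:
  "AE \<omega> in M. (\<lambda>k. horizon_integral k \<omega>) \<longlonglongrightarrow> Lim at_top (path_integral \<omega>)"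
  using AE_regular_path AE_path_integral_bounded
proof eventually_elim
  case (elim \<omega>)
  show ?case
    unfolding horizon_integral_eq[OF elim(1)]
    using elim by (intro Lim_at_top_stieltjes_integral[OF c_gt_1]) (simp_all add: regular_path_def)
qed

lemma mu_eq: "mu c M N L = distr M borel total_integral"
  unfolding mu_def
proof (rule distr_completion_cong_AE)
  show "AE \<omega> in M. Lim at_top (path_integral \<omega>) = total_integral \<omega>"
    using AE_horizon_integral_tendsto by eventually_elim (simp add: total_integral_def limI)
qed auto

lemma rho_eq: "rho M N L = distr M borel stopped_value"
  unfolding rho_def
proof (rule distr_completion_cong_AE)
  show "AE \<omega> in M. L (first_jump_time (\<lambda>t. N t \<omega>)) \<omega> = stopped_value \<omega>"
    using AE_regular_path by eventually_elim (simp add: stopped_value_eq)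
qed auto

lemma real_distribution_mu: "real_distribution (mu c M N L)"
  unfolding mu_eq by simp

lemma real_distribution_rho: "real_distribution (rho M N L)"
  unfolding rho_eq by simp

text \<open>As the mesh tends to 0 the contribution of multiple jumps disappears; the error caused
  by the finite horizon stays.\<close>

lemma char_horizon_approx:
  "cmod (char (distr M borel (horizon_integral k)) z -
      char (rho M N L) z * char (distr M borel (horizon_integral k)) (z / c))
    \<le> (1 + rate) / rate * (\<bar>z\<bar> * mean * exp (- decay) ^ k)"
proof (rule LIMSEQ_le)
  have G: "AE \<omega> in M. (\<lambda>m. grid_integral m k \<omega>) \<longlonglongrightarrow> horizon_integral k \<omega>"
    using AE_regular_path by eventually_elim (simp only: horizon_integral_eq grid_integral_tendsto)
  have S: "AE \<omega> in M. (\<lambda>m. grid.stopped_sum m \<omega>) \<longlonglongrightarrow> stopped_value \<omega>"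
    using AE_regular_path by eventually_elim (simp add: stopped_value_eq stopped_sum_tendsto)
  show "(\<lambda>m. cmod (char (distr M borel (grid_integral m k)) z -
      char (distr M borel (grid.stopped_sum m)) z * char (distr M borel (grid_integral m k)) (z / c)))
    \<longlonglongrightarrow> cmod (char (distr M borel (horizon_integral k)) z -
      char (rho M N L) z * char (distr M borel (horizon_integral k)) (z / c))"
    unfolding rho_eq
    by (intro tendsto_norm tendsto_diff tendsto_mult char_distr_tendsto G S
      grid.measurable_weighted_sum grid.measurable_stopped_sum measurable_horizon_integral measurable_stopped_value)
  have "(\<lambda>m. (1 + rate) / rate * (2 * rate ^ 2 * (1 / real (Suc m)) + \<bar>z\<bar> * mean * exp (- decay) ^ k))
    \<longlonglongrightarrow> (1 + rate) / rate * (2 * rate ^ 2 * 0 + \<bar>z\<bar> * mean * exp (- decay) ^ k)"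
    by (intro tendsto_mult tendsto_add tendsto_const LIMSEQ_Suc[OF lim_1_over_n])
  then show "(\<lambda>m. (1 + rate) / rate * (2 * rate ^ 2 * (1 / real (Suc m)) + \<bar>z\<bar> * mean * exp (- decay) ^ k))
    \<longlonglongrightarrow> (1 + rate) / rate * (\<bar>z\<bar> * mean * exp (- decay) ^ k)"
    by simp
qed (intro exI[of _ 0] allI impI char_grid_approx)

text \<open>Letting the horizon tend to infinity removes the remaining error, since exp(-decay) <
  1.\<close>

lemma char_mu_decomposition: "char (mu c M N L) z = char (rho M N L) z * char (mu c M N L) (inverse c * z)"
proof -
  have T: "AE \<omega> in M. (\<lambda>k. horizon_integral k \<omega>) \<longlonglongrightarrow> total_integral \<omega>"
    using AE_horizon_integral_tendsto by eventually_elim (simp add: total_integral_def limI)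
  have "cmod (char (mu c M N L) z - char (rho M N L) z * char (mu c M N L) (z / c)) \<le> 0"
  proof (rule LIMSEQ_le)
    show "(\<lambda>k. cmod (char (distr M borel (horizon_integral k)) z -
        char (rho M N L) z * char (distr M borel (horizon_integral k)) (z / c)))
      \<longlonglongrightarrow> cmod (char (mu c M N L) z - char (rho M N L) z * char (mu c M N L) (z / c))"
      unfolding mu_eq
      by (intro tendsto_norm tendsto_diff tendsto_mult tendsto_const char_distr_tendsto T
        measurable_horizon_integral measurable_total_integral)
    have "(\<lambda>k. (1 + rate) / rate * (\<bar>z\<bar> * mean * exp (- decay) ^ k)) \<longlonglongrightarrow> (1 + rate) / rate * (\<bar>z\<bar> * mean * 0)"
      using decay_pos by (intro tendsto_mult tendsto_const LIMSEQ_power_zero) auto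
    then show "(\<lambda>k. (1 + rate) / rate * (\<bar>z\<bar> * mean * exp (- decay) ^ k)) \<longlonglongrightarrow> 0"
      by simp
  qed (intro exI[of _ 0] allI impI char_horizon_approx)
  moreover have "inverse c * z = z / c"
    by (simp add: divide_inverse mult.commute)
  ultimately show ?thesis by simp
qed

lemma decomposable_mu: "decomposable (inverse c) (mu c M N L)"
  unfolding decomposable_def
  by (intro conjI exI[of _ "rho M N L"] allI real_distribution_mu real_distribution_rho char_mu_decomposition)
     (use c_gt_1 in \<open>auto simp: inverse_less_1_iff\<close>)

lemma char_mu_has_prod: "(\<lambda>n. char (rho M N L) (inverse c ^ n * z)) has_prod char (mu c M N L) z"
  by (intro char_has_prod real_distribution_mu char_mu_decomposition)
     (use c_gt_1 in \<open>auto simp: inverse_less_1_iff\<close>)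

end

section \<open>Compound Poisson processes with three atoms\<close>

lemma integral_levy_measure_k:
  fixes f :: "real \<times> real \<Rightarrow> complex"
  assumes "c > 1" "u \<ge> 0" "v \<ge> 0" "w \<ge> 0" and f: "f \<in> borel_measurable borel"
  shows "integral\<^sup>L (levy_measure_k c k u v w) f = u * f (1, 0) + v * f (0, 1) + w * f (1, c powi (- k))"
proof -
  define d where "d = c powi (- k)"
  let ?A = "{(1, 0), (0, 1), (1, d)} :: (real \<times> real) set"
  let ?m = "\<lambda>x :: real \<times> real. if x = (1, 0) then u else if x = (0, 1) then v else w"
  \<comment> \<open>This separates the atom (1, d) from (1, 0), so the sum over the set really has
    three terms.\<close>
  have d: "d \<noteq> 0" using assms(1) by (simp add: d_def)
  have "integral\<^sup>L (levy_measure_k c k u v w) f = integral\<^sup>L (point_measure ?A (\<lambda>x. ennreal (?m x))) f"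
    unfolding levy_measure_k_def d_def[symmetric] using f by (subst integral_distr) auto
  also have "\<dots> = (\<Sum>x\<in>?A. ?m x *\<^sub>R f x)"
    using assms by (intro lebesgue_integral_point_measure_finite) auto
  also have "\<dots> = u * f (1, 0) + v * f (0, 1) + w * f (1, d)"
    using d by (simp add: scaleR_conv_of_real)
  finally show ?thesis
    unfolding d_def .
qed

text \<open>The arguments (x, 0) and (0, x) in the joint exponent give the marginals. By uniqueness
  of characteristic functions N is Poisson with rate u + w, and \<open>L t\<close> is a Poisson
  variable of rate v t plus d times an independent one of rate w t.\<close>

lemma poisson_driven_pair_if_compound_poisson:
  fixes N L :: "real \<Rightarrow> 'a \<Rightarrow> real"
  assumes c: "c > 1" and uvw: "u \<ge> 0" "v \<ge> 0" "w \<ge> 0" "u + w > 0"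
    and cp: "compound_poisson_process M (levy_measure_k c k u v w) (\<lambda>t \<omega>. (N t \<omega>, L t \<omega>))"
  shows "poisson_driven_pair M N L c (u + w) (v + c powi (- k) * w)"
proof -
  define d where "d = c powi (- k)"
  have d: "0 \<le> d" using c by (simp add: d_def)
  have levy: "levy_process M (\<lambda>t \<omega>. (N t \<omega>, L t \<omega>))"
    using cp by (simp add: compound_poisson_process_def)
  then interpret prob_space M by (simp add: levy_process_def)
  have m: "(\<lambda>\<omega>. (N t \<omega>, L t \<omega>)) \<in> borel_measurable M" if "0 \<le> t" for t
    using levy that by (simp add: levy_process_def)
  have mN: "N t \<in> borel_measurable M" and mL: "L t \<in> borel_measurable M" if "0 \<le> t" for t
    using measurable_comp[OF m[OF that] borel_measurable_fst] measurable_comp[OF m[OF that] borel_measurable_snd]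
    by (simp_all add: comp_def)
  have char: "(CLINT \<omega>|M. iexp (z \<bullet> (N t \<omega>, L t \<omega>))) =
      exp (t * (u * (iexp (fst z) - 1) + v * (iexp (snd z) - 1) + w * (iexp (fst z + snd z * d) - 1)))"
    if "0 \<le> t" for t z
  proof -
    have "(CLINT \<omega>|M. iexp (z \<bullet> (N t \<omega>, L t \<omega>))) = exp (t * (CLINT x|levy_measure_k c k u v w. iexp (z \<bullet> x) - 1))"
      using cp that unfolding compound_poisson_process_def by blast
    also have "(CLINT x|levy_measure_k c k u v w. iexp (z \<bullet> x) - 1) =
      u * (iexp (z \<bullet> (1, 0)) - 1) + v * (iexp (z \<bullet> (0, 1)) - 1) + w * (iexp (z \<bullet> (1, d)) - 1)"
      unfolding d_def
      by (rule integral_levy_measure_k[OF c uvw(1-3)]) (intro borel_measurable_continuous_onI continuous_intros)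
    finally show ?thesis
      by (simp add: inner_prod_def)
  qed
  have law_N: "distr M borel (N t) = distr (measure_pmf (poisson_pmf ((u + w) * t))) borel real" if "0 < t" for t
  proof -
    have t: "0 \<le> t" and pos: "0 < (u + w) * t" using that uvw by simp_all
    have law: "poisson_pmf ((u + w) * t) = poisson_law ((u + w) * t)"
      using pos by (metis less_irrefl poisson_law_def)
    have "char (distr M borel (N t)) x = char (distr (measure_pmf (poisson_law ((u + w) * t))) borel real) x" for x
    proof -
      have "char (distr M borel (N t)) x = (CLINT \<omega>|M. iexp ((x, 0) \<bullet> (N t \<omega>, L t \<omega>)))"
        unfolding char_def using mN[OF t] by (subst integral_distr) (auto simp: inner_prod_def)
      also have "\<dots> = exp (((u + w) * t) * (iexp x - 1))"
        unfolding char[OF t] by (simp add: algebra_simps)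
      also have "\<dots> = char (distr (measure_pmf (poisson_law ((u + w) * t))) borel real) x"
        using char_distr_poisson_law[OF less_imp_le[OF pos]] by simp
      finally show ?thesis .
    qed
    then show ?thesis
      unfolding law using mN[OF t]
      by (intro Levy_uniqueness ext) (auto intro!: prob_space.real_distribution_distr[OF measure_pmf.prob_space_axioms])
  qed
  have L: "(AE \<omega> in M. 0 \<le> L t \<omega>) \<and> integrable M (L t) \<and> expectation (L t) = (v + d * w) * t" if t: "0 \<le> t" for t
  proof -
    have "0 \<le> v * t" "0 \<le> w * t" using uvw t by simp_all
    then obtain K where K: "real_distribution K"
      "\<And>x. char K x = exp ((v * t) * (iexp x - 1) + (w * t) * (iexp (x * d) - 1))"
      "AE y in K. 0 \<le> y" "integrable K (\<lambda>y. y)" "integral\<^sup>L K (\<lambda>y. y) = v * t + d * (w * t)"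
      using d by (rule ex_compound_poisson_two_atoms) blast
    have "char (distr M borel (L t)) x = char K x" for x
    proof -
      have "char (distr M borel (L t)) x = (CLINT \<omega>|M. iexp ((0, x) \<bullet> (N t \<omega>, L t \<omega>)))"
        unfolding char_def using mL[OF t] by (subst integral_distr) (auto simp: inner_prod_def)
      also have "\<dots> = char K x"
        unfolding char[OF t] K(2) by (simp add: algebra_simps)
      finally show ?thesis .
    qed
    then have law: "distr M borel (L t) = K"
      using mL[OF t] K(1) by (intro Levy_uniqueness ext) auto
    show ?thesis
    proof (intro conjI)
      show "AE \<omega> in M. 0 \<le> L t \<omega>"
        using K(3) mL[OF t] unfolding law[symmetric] by (subst (asm) AE_distr_iff) auto
      show "integrable M (L t)"
        using K(4) mL[OF t] unfolding law[symmetric] by (subst (asm) integrable_distr_eq) auto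
      show "expectation (L t) = (v + d * w) * t"
        using K(5) mL[OF t] unfolding law[symmetric] by (subst (asm) integral_distr) (auto simp: algebra_simps)
    qed
  qed
  show ?thesis
    unfolding d_def[symmetric]
  proof unfold_locales
    show "AE \<omega> in M. N 0 \<omega> = 0 \<and> L 0 \<omega> = 0"
      using levy by (simp add: levy_process_def zero_prod_def)
    show "independent_increments M (\<lambda>t \<omega>. (N t \<omega>, L t \<omega>))" "stationary_increments M (\<lambda>t \<omega>. (N t \<omega>, L t \<omega>))"
      "AE \<omega> in M. cadlag (\<lambda>t. (N t \<omega>, L t \<omega>))"
      using levy by (simp_all add: levy_process_def)
  qed (use c uvw mN mL law_N L in auto)
qed

theorem proposition2p2:
  fixes c u v w p q r :: real and k :: int
    and M :: "'a measure" and N L :: "real \<Rightarrow> 'a \<Rightarrow> real"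
  assumes "c > 1"
    and "u \<ge> 0" "v \<ge> 0" "w \<ge> 0"
    and "p = u / (u + v + w)" "q = v / (u + v + w)" "r = w / (u + v + w)"
    and "p \<ge> 0" "q \<ge> 0" "r \<ge> 0" "p + q + r = 1" "p + r > 0" "q + r > 0"
    and "compound_poisson_process M (levy_measure_k c k u v w) (\<lambda>t \<omega>. (N t \<omega>, L t \<omega>))"
  shows "decomposable (inverse c) (mu c M N L)
    \<and> (\<forall>z. char (mu c M N L) z = char (rho M N L) z * char (mu c M N L) (inverse c * z))
    \<and> (\<forall>z. (\<lambda>n. char (rho M N L) (inverse c ^ n * z)) has_prod char (mu c M N L) z)"
proof -
  \<comment> \<open>p + r is the share of the jumps that move N; its positivity makes the intensity
    of N positive.\<close>
  have "p + r = (u + w) / (u + v + w)"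
    using assms(5,7) by (simp add: add_divide_distrib)
  then have "0 < u + w"
    using assms(2-4,12) by (simp add: zero_less_divide_iff)
  then interpret poisson_driven_pair M N L c "u + w" "v + c powi (- k) * w"
    using assms by (intro poisson_driven_pair_if_compound_poisson)
  show ?thesis
    using decomposable_mu char_mu_decomposition char_mu_has_prod by blast
qed

end
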